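(* Let $\theta\in(0,\pi/2)$ be fixed. For $\lambda \ge \frac{1}{d\cdot s_d(q(\theta))}$, $$\alpha_d^\theta(\lambda) \ge (1+o(1)) \frac{c_\theta\cdot d}{s_d(\theta)},$$ where $o(1)$ is as $d\to\infty$.
   Context: $S_{d-1}$ is the unit sphere in $\mathbb{R}^d$, with normalized surface area $s(\cdot)$ (so $s(S_{d-1})=1$). $s_d(\theta)$ is the normalized surface area of a spherical cap $\{y \in S_{d-1}: \langle x,y\rangle\ge\cos\theta\}$ of angular radius $\theta$, i.e. $$s_d(\theta) = \frac{1}{\sqrt{\pi}} \frac{\Gamma(d/2)}{\Gamma((d-1)/2)} \int_0^\theta \sin^{d-2} x \, dx.$$ $q(\theta)$ is the angular radius of the smallest spherical cap that contains the intersection of two spherical caps of angular radius $\theta$ whose centers are at angle $\theta$; that is, $$q(\theta) = \arcsin\left(\frac{\sqrt{(\cos\theta-1)^2(1+2\cos\theta)}}{\sin\theta}\right),$$ and $$c_\theta = \log\left(\frac{\sin\theta}{\sin q(\theta)}\right) = \log \frac{\sin^2\theta}{\sqrt{(1-\cos\theta)^2(1+2\cos\theta)}}$$ with $\log$ the natural logarithm. Hard cap model: for $\lambda>0$, the grand canonical hard cap model at fugacity $\lambda$ is the random set $\mathbf{X}\subset S_{d-1}$ given by a Poisson point process of intensity $\lambda$ on $S_{d-1}$ (with $s$ as the underlying measure) conditioned on the event that $\langle x,y\rangle\le\cos\theta$ for all distinct $x,y\in\mathbf{X}$. $\alpha_d^\theta(\lambda) = \mathbb{E}_\lambda[|\mathbf{X}|]$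 is its expected size. Equivalently, with $\hat Z_d^\theta(0)=1$, $$\hat Z_d^\theta(k) = \frac{1}{k!}\int_{S_{d-1}^k} \mathbf{1}\big[\langle x_i,x_j\rangle\le\cos\theta \ \ \forall\, 1\le i<j\le k\big]\, ds(x_1)\cdots ds(x_k), \qquad Z_d^\theta(\lambda) = \sum_{k\ge0}\lambda^k \hat Z_d^\theta(k),$$ one has $\mathbb{P}_\lambda[|\mathbf{X}|=k] = \lambda^k\hat Z_d^\theta(k)/Z_d^\theta(\lambda)$ and $$\alpha_d^\theta(\lambda) = \sum_{k\ge0} k\,\frac{\lambda^k \hat Z_d^\theta(k)}{Z_d^\theta(\lambda)} = \lambda\cdot\big(\log Z_d^\theta(\lambda)\big)'.$$ *)

theory Defs
  imports "HOL-Probability.Probability"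
begin

text \<open>
  The dimension \<open>d\<close> has to range over all natural numbers within one proposition, so points of
  \<open>d\<close>-dimensional space are functions in \<open>space (\<Pi>\<^sub>M i\<in>{..<d}. borel)\<close>, that is, functions with value
  \<^term>\<open>undefined\<close> outside \<open>{..<d}\<close>.
\<close>

definition dot :: "nat \<Rightarrow> (nat \<Rightarrow> real) \<Rightarrow> (nat \<Rightarrow> real) \<Rightarrow> real"
  where "dot d x y = (\<Sum>i<d. x i * y i)"

definition unit_sphere :: "nat \<Rightarrow> (nat \<Rightarrow> real) set"
  where "unit_sphere d = {x \<in> {..<d} \<rightarrow>\<^sub>E UNIV. dot d x x = 1}"

definition unit_ball :: "nat \<Rightarrow> (nat \<Rightarrow> real) set"
  where "unit_ball d = {x \<in> {..<d} \<rightarrow>\<^sub>E UNIV. dot d x x \<le> 1}"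

definition radial_projection :: "nat \<Rightarrow> (nat \<Rightarrow> real) \<Rightarrow> (nat \<Rightarrow> real)"
  where "radial_projection d x = (\<lambda>i\<in>{..<d}. x i / sqrt (dot d x x))"

text \<open>
  Normalized surface area on the unit sphere as the cone measure: the area of \<open>A\<close> is the volume of
  the cone \<open>{t x | x \<in> A, 0 < t \<le> 1}\<close> divided by the volume of the unit ball.
  For \<open>d \<ge> 1\<close> the push-forward below gives the complement of the sphere (in particular the image
  of the origin, which is no unit vector) measure zero, so restricting it loses no mass.
\<close>

definition sphere_measure :: "nat \<Rightarrow> (nat \<Rightarrow> real) measure"
  where "sphere_measure d =
    restrict_space
      (distr (uniform_measure (\<Pi>\<^sub>M i\<in>{..<d}. lborel) (unit_ball d))
             (\<Pi>\<^sub>M i\<in>{..<d}. borel) (radial_projection d))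
      (unit_sphere d)"

definition spherical_cap :: "nat \<Rightarrow> (nat \<Rightarrow> real) \<Rightarrow> real \<Rightarrow> (nat \<Rightarrow> real) set"
  where "spherical_cap d x \<theta> = {y \<in> unit_sphere d. dot d x y \<ge> cos \<theta>}"

definition pole :: "nat \<Rightarrow> (nat \<Rightarrow> real)"
  where "pole d = (\<lambda>i\<in>{..<d}. if i = 0 then 1 else 0)"

text \<open>The choice of the centre is immaterial by rotation invariance.\<close>

definition cap_area :: "nat \<Rightarrow> real \<Rightarrow> real"
  where "cap_area d \<theta> = measure (sphere_measure d) (spherical_cap d (pole d) \<theta>)"

text \<open>
  Angular radius of the smallest spherical cap that contains the intersection of two spherical caps
  of angular radius \<open>\<theta>\<close> whose centres are at angle \<open>\<theta>\<close>.
\<close>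

definition q_angle :: "real \<Rightarrow> real"
  where "q_angle \<theta> = arcsin (sqrt ((cos \<theta> - 1)\<^sup>2 * (1 + 2 * cos \<theta>)) / sin \<theta>)"

definition c_const :: "real \<Rightarrow> real"
  where "c_const \<theta> = ln (sin \<theta> / sin (q_angle \<theta>))"

text \<open>
  A Poisson point process whose intensity measure is \<open>lam\<close> times a probability measure \<open>S\<close> is realized
  by a Poisson(\<open>lam\<close>) number of independent points of law \<open>S\<close>. An outcome \<open>(n, x)\<close> stands for the
  configuration \<open>{x 0, \<dots>, x (n - 1)}\<close>; the remaining entries of the sequence \<open>x\<close> are not used.
\<close>

definition poisson_process :: "real \<Rightarrow> 'a measure \<Rightarrow> (nat \<times> (nat \<Rightarrow> 'a)) measure"
  where "poisson_process lam S = measure_pmf (poisson_pmf lam) \<Otimes>\<^sub>M (\<Pi>\<^sub>M i\<in>UNIV. S)"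

definition config :: "nat \<times> (nat \<Rightarrow> 'a) \<Rightarrow> 'a set"
  where "config \<omega> = snd \<omega> ` {..<fst \<omega>}"

definition hard_cap_event :: "nat \<Rightarrow> real \<Rightarrow> real \<Rightarrow> (nat \<times> (nat \<Rightarrow> nat \<Rightarrow> real)) set"
  where "hard_cap_event d \<theta> lam =
    {\<omega> \<in> space (poisson_process lam (sphere_measure d)).
       \<forall>x\<in>config \<omega>. \<forall>y\<in>config \<omega>. x \<noteq> y \<longrightarrow> dot d x y \<le> cos \<theta>}"

definition hard_cap_model :: "nat \<Rightarrow> real \<Rightarrow> real \<Rightarrow> (nat \<times> (nat \<Rightarrow> nat \<Rightarrow> real)) measure"
  where "hard_cap_model d \<theta> lam =
    uniform_measure (poisson_process lam (sphere_measure d)) (hard_cap_event d \<theta> lam)"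

definition expected_size :: "nat \<Rightarrow> real \<Rightarrow> real \<Rightarrow> real"
  where "expected_size d \<theta> lam = (LINT \<omega>|hard_cap_model d \<theta> lam. real (card (config \<omega>)))"

end

theory Submission
  imports Defs "HOL-Combinatorics.Transposition" "HOL-Real_Asymp.Real_Asymp"
begin

text \<open>
  Let \<open>\<alpha>\<close> be the mean number of points, \<open>s\<close> the normalized area, \<open>N u\<close> the open cap of radius \<open>\<theta>\<close>
  around a point \<open>u\<close>, and, for a configuration \<open>X\<close>, let \<open>T u\<close> be the part of \<open>N u\<close> that is not blocked
  by points of \<open>X\<close> outside \<open>N u\<close>. Two inequalities pull \<open>\<alpha>\<close> in opposite directions as the size of
  \<open>T u\<close> varies. Write \<open>z\<close> for the mean of \<open>lam * s (T u)\<close> over a uniform \<open>u\<close> and a random \<open>X\<close>.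

  The first inequality is \<open>\<alpha> \<ge> lam * exp (- z)\<close>. By the Mecke formula (\<open>mecke\<close>), \<open>\<alpha> / lam\<close> is the
  probability that no point of \<open>X\<close> lies in \<open>N u\<close>. Given the points outside \<open>N u\<close>, those inside form
  a hard-core process on \<open>T u\<close>, which is empty with probability at least \<open>exp (- lam * s (T u))\<close>
  (\<open>void_lower_bound\<close>); it remains to apply Jensen's inequality.

  The second inequality is \<open>\<alpha> * s\<^sub>d \<theta> \<ge> z * exp (- 2 * lam * s\<^sub>d q)\<close>. The left-hand side is an upper bound
  for the mean number of points in \<open>N u\<close>, which by the Mecke formula is \<open>lam\<close> times the mean area of those \<open>v\<close> in \<open>T u\<close> for
  which \<open>N v\<close> contains no point of \<open>X\<close> in \<open>N u\<close>. By the void estimate again, each \<open>v\<close> contributes at least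
  \<open>exp (- lam * s (T u \<inter> N v))\<close>. The average of \<open>s (T u \<inter> N v)\<close> over \<open>v\<close> in \<open>T u\<close> is at most \<open>2 * s\<^sub>d q\<close>
  (\<open>mean_overlap_bound\<close>): in a pair \<open>v\<close>, \<open>v'\<close> at distance less than \<open>\<theta>\<close>, the point closer to \<open>u\<close> lies
  in the intersection of a cap of radius \<open>\<theta>\<close> around the other one with a cap around \<open>u\<close>, and this
  intersection fits into a cap of radius \<open>q\<close> (\<open>common_cap\<close>).

  At \<open>lam = 1 / (d * s\<^sub>d q)\<close> the factor \<open>exp (- 2 * lam * s\<^sub>d q)\<close> is \<open>exp (- 2 / d)\<close>. The two bounds balance when
  \<open>z * exp z\<close> is about \<open>lam * s\<^sub>d \<theta> = s\<^sub>d \<theta> / (d * s\<^sub>d q)\<close>. Comparing cones with cylinders shows that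
  the ratio \<open>s\<^sub>d \<theta> / s\<^sub>d q\<close> is at least \<open>(sin \<theta> / sin q) ^ d\<close> up to factors polynomial in \<open>d\<close>
  (\<open>cap_area_ratio\<close>), so \<open>z\<close> is about \<open>c * d\<close>, and the claim follows for this \<open>lam\<close>. It extends to
  all larger \<open>lam\<close> because the mean size increases with the intensity (\<open>mean_size_mono\<close>).
\<close>

section \<open>Sums and integrals in the extended nonnegative reals\<close>

lemma borel_measurable_of_bool [measurable]:
  assumes [measurable]: "Measurable.pred M P"
  shows "(\<lambda>x. of_bool (P x) :: ennreal) \<in> borel_measurable M"
  unfolding of_bool_def by measurable

lemma suminf_ennreal_head: "suminf f = f 0 + (\<Sum>n. f (Suc n))" for f :: "nat \<Rightarrow> ennreal"
  using suminf_offset[of f 1] by (simp add: add.commute)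

lemma all_transpose:
  assumes "i < n"
  shows "(\<forall>j<n. P (Transposition.transpose 0 i j)) \<longleftrightarrow> (\<forall>j<n::nat. P j)"
  using assms
  by (metis (no_types, opaque_lifting) Transposition.transpose_def bot_nat_0.not_eq_extremum not_less_zero transpose_involutory)

lemma suminf_of_bool_eq: "(\<Sum>k. of_bool (c = k) :: ennreal) = 1"
  using suminf_finite[of "{c}" "\<lambda>k. of_bool (c = k) :: ennreal"] by auto

lemma exp_tangent:
  assumes "0 \<le> y" "0 \<le> b"
  shows "ennreal (exp (- b)) * ennreal (1 + b) \<le> ennreal (exp (- y)) + ennreal (exp (- b)) * ennreal y"
proof -
  have "1 + (b - y) \<le> exp (b - y)" by (rule exp_ge_add_one_self)
  then have "exp (- b) * (1 + (b - y)) \<le> exp (- b) * exp (b - y)" by (intro mult_left_mono) auto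
  also have "\<dots> = exp (- y)" by (simp add: exp_add[symmetric])
  finally have "exp (- b) * (1 + b) \<le> exp (- y) + exp (- b) * y" by (simp add: algebra_simps)
  then show ?thesis using assms
    by (simp add: ennreal_mult[symmetric] ennreal_plus[symmetric] del: ennreal_plus)
qed

text \<open>
  Jensen's inequality for the exponential, in a form that only needs an upper bound \<open>b\<close> for the
  mean of \<open>y\<close> under the weight \<open>w\<close>: integrate the tangent inequality at \<open>b\<close>.
\<close>

lemma jensen_exp_nn_integral:
  assumes [measurable]: "w \<in> borel_measurable M" "y \<in> borel_measurable M"
    and y: "\<And>x. 0 \<le> y x" and b: "0 \<le> b"
    and le: "(\<integral>\<^sup>+x. w x * ennreal (y x) \<partial>M) \<le> ennreal b * (\<integral>\<^sup>+x. w x \<partial>M)"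
    and fin: "(\<integral>\<^sup>+x. w x \<partial>M) < \<infinity>"
  shows "ennreal (exp (- b)) * (\<integral>\<^sup>+x. w x \<partial>M) \<le> (\<integral>\<^sup>+x. w x * ennreal (exp (- y x)) \<partial>M)"
proof -
  let ?W = "\<integral>\<^sup>+x. w x \<partial>M" and ?e = "ennreal (exp (- b))"
  have "?e * ennreal b * ?W + ?e * ?W = (?e * ennreal (1 + b)) * ?W"
    using b by (simp add: algebra_simps)
  also have "\<dots> = (\<integral>\<^sup>+x. (?e * ennreal (1 + b)) * w x \<partial>M)"
    by (rule nn_integral_cmult[symmetric]) measurable
  also have "\<dots> \<le> (\<integral>\<^sup>+x. (ennreal (exp (- y x)) + ?e * ennreal (y x)) * w x \<partial>M)"
    by (intro nn_integral_mono mult_right_mono exp_tangent y b) auto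
  also have "\<dots> = (\<integral>\<^sup>+x. w x * ennreal (exp (- y x)) \<partial>M) + ?e * (\<integral>\<^sup>+x. w x * ennreal (y x) \<partial>M)"
  proof -
    have "(\<integral>\<^sup>+x. (ennreal (exp (- y x)) + ?e * ennreal (y x)) * w x \<partial>M) =
        (\<integral>\<^sup>+x. w x * ennreal (exp (- y x)) + ?e * (w x * ennreal (y x)) \<partial>M)"
      by (intro nn_integral_cong) (simp add: distrib_left mult_ac)
    then show ?thesis by (simp add: nn_integral_add nn_integral_cmult)
  qed
  also have "\<dots> \<le> (\<integral>\<^sup>+x. w x * ennreal (exp (- y x)) \<partial>M) + ?e * (ennreal b * ?W)"
    by (intro add_left_mono mult_left_mono le) auto
  finally have "?e * ennreal b * ?W + ?e * ?W \<le> ?e * ennreal b * ?W + (\<integral>\<^sup>+x. w x * ennreal (exp (- y x)) \<partial>M)"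
    by (simp add: add.commute mult.assoc)
  moreover have "?e * ennreal b * ?W \<noteq> top"
    using fin by (simp add: ennreal_mult_eq_top_iff)
  ultimately show ?thesis by (simp only: ennreal_add_left_cancel_le) auto
qed

section \<open>The Poisson process and the Mecke formula\<close>

text \<open>
  A Poisson process with intensity \<open>lam\<close> times a probability measure \<open>S\<close>, together with a relation
  \<open>K\<close> that says which pairs of points exclude each other. Conditioning on the absence of excluded
  pairs is done by hand: all integrals below are with respect to the Poisson process and carry the
  indicator of this event as a weight.
\<close>

locale hard_core = prob_space S for S :: "'a measure" +
  fixes K :: "'a \<Rightarrow> 'a \<Rightarrow> bool" and lam :: real
  assumes K_sym: "K x y \<longleftrightarrow> K y x"
    and K_measurable: "Measurable.pred (S \<Otimes>\<^sub>M S) (\<lambda>p. K (fst p) (snd p))"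
    and lam_pos: "lam > 0"
begin

sublocale seq: sequence_space S ..

abbreviation "PP \<equiv> poisson_process lam S"

lemma K_measurable' [measurable (raw)]:
  assumes [measurable]: "f \<in> measurable M S" "g \<in> measurable M S"
  shows "Measurable.pred M (\<lambda>x. K (f x) (g x))"
proof -
  have "(\<lambda>x. (f x, g x)) \<in> measurable M (S \<Otimes>\<^sub>M S)" by measurable
  from measurable_compose[OF this K_measurable] show ?thesis by simp
qed

lemma prob_space_PP: "prob_space PP"
  unfolding poisson_process_def
  by (intro prob_space_pair prob_space_measure_pmf seq.P.prob_space_axioms)

sublocale PP: prob_space PP by (rule prob_space_PP)

lemma sets_PP [measurable_cong]: "sets PP = sets (count_space UNIV \<Otimes>\<^sub>M (\<Pi>\<^sub>M i\<in>UNIV. S))"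
  unfolding poisson_process_def by (intro sets_pair_measure_cong) auto

lemma space_PP: "space PP = UNIV \<times> (UNIV \<rightarrow> space S)"
  unfolding poisson_process_def by (auto simp: space_pair_measure space_PiM)

lemma snd_PP_in_space: "\<omega> \<in> space PP \<Longrightarrow> snd \<omega> i \<in> space S"
  by (auto simp: space_PP)

lemma nn_integral_PP:
  assumes [measurable]: "F \<in> borel_measurable PP"
  shows "(\<integral>\<^sup>+\<omega>. F \<omega> \<partial>PP) =
    (\<Sum>n. ennreal (lam ^ n / fact n * exp (- lam)) * (\<integral>\<^sup>+x. F (n, x) \<partial>(\<Pi>\<^sub>M i\<in>UNIV. S)))"
proof -
  have "(\<integral>\<^sup>+\<omega>. F \<omega> \<partial>PP) = (\<integral>\<^sup>+n. \<integral>\<^sup>+x. F (n, x) \<partial>(\<Pi>\<^sub>M i\<in>UNIV. S) \<partial>measure_pmf (poisson_pmf lam))"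
    unfolding poisson_process_def
    by (subst seq.P.nn_integral_fst[symmetric])
       (use assms in \<open>auto simp: poisson_process_def\<close>)
  also have "\<dots> = (\<integral>\<^sup>+n. ennreal (pmf (poisson_pmf lam) n) * (\<integral>\<^sup>+x. F (n, x) \<partial>(\<Pi>\<^sub>M i\<in>UNIV. S)) \<partial>count_space UNIV)"
    by (rule nn_integral_measure_pmf)
  finally show ?thesis using lam_pos by (simp add: nn_integral_count_space_nat)
qed

text \<open>
  Exchanging the entries \<open>0\<close> and \<open>i\<close> allows a sum over all points of a configuration to be reduced
  to the contribution of the entry \<open>0\<close>.
\<close>

definition swap_first :: "nat \<Rightarrow> nat \<times> (nat \<Rightarrow> 'a) \<Rightarrow> nat \<times> (nat \<Rightarrow> 'a)"
  where "swap_first i \<omega> = (fst \<omega>, \<lambda>j. snd \<omega> (Transposition.transpose 0 i j))"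

definition add_point :: "'a \<Rightarrow> nat \<times> (nat \<Rightarrow> 'a) \<Rightarrow> nat \<times> (nat \<Rightarrow> 'a)"
  where "add_point u \<omega> = (Suc (fst \<omega>), case_nat u (snd \<omega>))"

lemma swap_first_measurable [measurable]: "swap_first i \<in> measurable PP PP"
proof -
  have "swap_first i \<in> measurable PP (count_space UNIV \<Otimes>\<^sub>M (\<Pi>\<^sub>M i\<in>UNIV. S))"
    unfolding swap_first_def
  proof (intro measurable_Pair measurable_PiM_single')
    fix j
    show "(\<lambda>\<omega>. snd \<omega> (Transposition.transpose 0 i j)) \<in> measurable PP S"
      by measurable
  qed (auto simp: space_PP)
  then show ?thesis
    by (simp add: measurable_cong_sets[OF refl sets_PP])
qed

lemma add_point_measurable [measurable (raw)]:
  assumes f [measurable]: "f \<in> measurable M S" and g: "g \<in> measurable M PP"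
  shows "(\<lambda>z. add_point (f z) (g z)) \<in> measurable M PP"
proof -
  have [measurable]: "g \<in> measurable M (count_space UNIV \<Otimes>\<^sub>M (\<Pi>\<^sub>M i\<in>UNIV. S))"
    using g by (simp add: measurable_cong_sets[OF refl sets_PP])
  have "(\<lambda>z. add_point (f z) (g z)) \<in> measurable M (count_space UNIV \<Otimes>\<^sub>M (\<Pi>\<^sub>M i\<in>UNIV. S))"
    unfolding add_point_def
  proof (intro measurable_Pair measurable_PiM_single')
    show "(\<lambda>z. Suc (fst (g z))) \<in> measurable M (count_space UNIV)" by measurable
    show "(\<lambda>z. case_nat (f z) (snd (g z))) \<in> space M \<rightarrow> (UNIV \<rightarrow>\<^sub>E space S)"
      using measurable_space[OF f] snd_PP_in_space[OF measurable_space[OF g]]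
      by (auto split: nat.split)
    fix j
    have [measurable]: "(\<lambda>z. snd (g z) i) \<in> measurable M S" for i by measurable
    show "(\<lambda>z. case_nat (f z) (snd (g z)) j) \<in> measurable M S"
      by (cases j) simp_all
  qed
  then show ?thesis
    by (simp add: measurable_cong_sets[OF refl sets_PP])
qed

lemma sum_points_measurable [measurable (raw)]:
  fixes f :: "nat \<Rightarrow> 'b \<Rightarrow> ennreal"
  assumes f: "\<And>i. f i \<in> borel_measurable M" and [measurable]: "g \<in> measurable M (count_space UNIV)"
  shows "(\<lambda>z. \<Sum>i<g z. f i z) \<in> borel_measurable M"
proof (rule measurable_compose_countable[where f = "\<lambda>n z. \<Sum>i<n. f i z"])
  show "(\<lambda>z. \<Sum>i<n. f i z) \<in> borel_measurable M" for n
    by (intro borel_measurable_sum f)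
qed fact

lemma nn_integral_swap_first:
  assumes [measurable]: "F \<in> borel_measurable PP"
  shows "(\<integral>\<^sup>+x. F (swap_first i (n, x)) \<partial>(\<Pi>\<^sub>M i\<in>UNIV. S)) = (\<integral>\<^sup>+x. F (n, x) \<partial>(\<Pi>\<^sub>M i\<in>UNIV. S))"
    (is "?l = integral\<^sup>N ?P _")
proof -
  let ?t = "\<lambda>x j. x (Transposition.transpose 0 i j) :: 'a"
  have [measurable]: "?t \<in> measurable ?P ?P"
    by (intro measurable_PiM_single') (auto simp: space_PiM PiE_def Pi_def)
  have [measurable]: "F \<in> borel_measurable (count_space UNIV \<Otimes>\<^sub>M ?P)"
    using assms by (simp add: measurable_cong_sets[OF sets_PP refl])
  have "distr ?P ?P ?t = ?P"
    using distr_PiM_reindex[of UNIV "\<lambda>_. S" "Transposition.transpose 0 i" UNIV]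
    by (simp add: prob_space_axioms restrict_def)
  then have "(\<integral>\<^sup>+x. F (n, x) \<partial>?P) = (\<integral>\<^sup>+x. F (n, x) \<partial>distr ?P ?P ?t)" by simp
  also have "\<dots> = ?l"
    by (subst nn_integral_distr) (simp_all add: swap_first_def)
  finally show ?thesis ..
qed

lemma nn_integral_add_point:
  assumes [measurable]: "F \<in> borel_measurable PP"
  shows "(\<integral>\<^sup>+x. F (Suc n, x) \<partial>(\<Pi>\<^sub>M i\<in>UNIV. S)) =
    (\<integral>\<^sup>+x. \<integral>\<^sup>+u. F (add_point u (n, x)) \<partial>S \<partial>(\<Pi>\<^sub>M i\<in>UNIV. S))" (is "integral\<^sup>N ?P _ = _")
proof -
  have [measurable]: "F \<in> borel_measurable (count_space UNIV \<Otimes>\<^sub>M ?P)"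
    using assms by (simp add: measurable_cong_sets[OF sets_PP refl])
  interpret pair_sigma_finite S ?P ..
  have "(\<integral>\<^sup>+x. F (Suc n, x) \<partial>?P) =
      (\<integral>\<^sup>+x. F (Suc n, x) \<partial>distr (S \<Otimes>\<^sub>M ?P) ?P (\<lambda>(s, \<omega>). case_nat s \<omega>))"
    by (simp add: seq.PiM_iter)
  also have "\<dots> = (\<integral>\<^sup>+p. F (Suc n, case_nat (fst p) (snd p)) \<partial>(S \<Otimes>\<^sub>M ?P))"
    by (subst nn_integral_distr) (simp_all add: case_prod_beta)
  also have "\<dots> = (\<integral>\<^sup>+x. \<integral>\<^sup>+u. F (Suc n, case_nat u x) \<partial>S \<partial>?P)"
    by (subst nn_integral_snd[symmetric]) (simp_all add: case_prod_beta)
  finally show ?thesis by (simp add: add_point_def)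
qed

text \<open>
  The law of an i.i.d. sequence is invariant under exchanging entries, so every summand has the same
  integral as \<open>i = 0\<close>. Splitting off the entry \<open>0\<close> of a sequence of length \<open>n + 1\<close> leaves a
  sequence of length \<open>n\<close> and an independent point \<open>u\<close>, and the Poisson weights satisfy
  \<open>(n + 1) * w (n + 1) = lam * w n\<close>.
\<close>

lemma mecke:
  assumes [measurable]: "F \<in> borel_measurable PP"
  shows "(\<integral>\<^sup>+\<omega>. (\<Sum>i<fst \<omega>. F (swap_first i \<omega>)) \<partial>PP) =
    ennreal lam * (\<integral>\<^sup>+\<omega>. \<integral>\<^sup>+u. F (add_point u \<omega>) \<partial>S \<partial>PP)"
proof -
  let ?P = "\<Pi>\<^sub>M i\<in>UNIV. S" and ?w = "\<lambda>n. lam ^ n / fact n * exp (- lam)"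
  have F': "F \<in> borel_measurable (count_space UNIV \<Otimes>\<^sub>M ?P)"
    using assms by (simp add: measurable_cong_sets[OF sets_PP refl])
  have sw: "(\<lambda>x. F (swap_first i (n, x))) \<in> borel_measurable ?P" for i n
  proof -
    have "(\<lambda>\<omega>. F (swap_first i \<omega>)) \<in> borel_measurable (count_space UNIV \<Otimes>\<^sub>M ?P)"
      unfolding measurable_cong_sets[OF sets_PP[symmetric] refl] by measurable
    then show ?thesis by measurable
  qed
  have "(\<integral>\<^sup>+\<omega>. (\<Sum>i<fst \<omega>. F (swap_first i \<omega>)) \<partial>PP) =
      (\<Sum>n. ennreal (?w n) * (\<integral>\<^sup>+x. (\<Sum>i<n. F (swap_first i (n, x))) \<partial>?P))"
    by (subst nn_integral_PP) simp_all
  also have "\<dots> = (\<Sum>n. ennreal (?w n) * (of_nat n * (\<integral>\<^sup>+x. F (n, x) \<partial>?P)))"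
    by (simp add: nn_integral_sum sw nn_integral_swap_first)
  also have "\<dots> = (\<Sum>n. ennreal (?w (Suc n)) * (of_nat (Suc n) * (\<integral>\<^sup>+x. F (Suc n, x) \<partial>?P)))"
    by (subst suminf_ennreal_head) simp
  also have "\<dots> = (\<Sum>n. ennreal lam * (ennreal (?w n) * (\<integral>\<^sup>+x. F (Suc n, x) \<partial>?P)))"
  proof (rule suminf_cong)
    fix n
    have "ennreal (?w (Suc n)) * of_nat (Suc n) = ennreal (?w (Suc n) * real (Suc n))"
      using lam_pos by (subst ennreal_mult) (auto simp: ennreal_of_nat_eq_real_of_nat)
    also have "?w (Suc n) * real (Suc n) = lam * ?w n"
      by (simp add: divide_simps del: of_nat_Suc)
    also have "ennreal \<dots> = ennreal lam * ennreal (?w n)"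
      using lam_pos by (intro ennreal_mult) auto
    finally show "ennreal (?w (Suc n)) * (of_nat (Suc n) * (\<integral>\<^sup>+x. F (Suc n, x) \<partial>?P)) =
        ennreal lam * (ennreal (?w n) * (\<integral>\<^sup>+x. F (Suc n, x) \<partial>?P))"
      by (simp add: mult.assoc[symmetric])
  qed
  also have "\<dots> = ennreal lam * (\<integral>\<^sup>+\<omega>. \<integral>\<^sup>+u. F (add_point u \<omega>) \<partial>S \<partial>PP)"
    by (subst nn_integral_PP) (simp_all add: nn_integral_add_point)
  finally show ?thesis .
qed

section \<open>Void probabilities of the hard-core process\<close>

text \<open>
  Excluded pairs are formulated for indices rather than for points, so that two equal entries count
  as a pair; this keeps the condition stable under \<open>add_point\<close>.
\<close>

definition compatible :: "nat \<times> (nat \<Rightarrow> 'a) \<Rightarrow> bool"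
  where "compatible \<omega> \<longleftrightarrow> (\<forall>i<fst \<omega>. \<forall>j<fst \<omega>. i \<noteq> j \<longrightarrow> \<not> K (snd \<omega> i) (snd \<omega> j))"

text \<open>
  Only points outside \<open>D\<close> count, because the void estimate for \<open>D\<close> conditions on these. For empty
  \<open>D\<close> this says that the point may be added to the configuration.
\<close>

definition free :: "('a \<Rightarrow> bool) \<Rightarrow> nat \<times> (nat \<Rightarrow> 'a) \<Rightarrow> 'a \<Rightarrow> bool"
  where "free D \<omega> v \<longleftrightarrow> (\<forall>i<fst \<omega>. \<not> D (snd \<omega> i) \<longrightarrow> \<not> K v (snd \<omega> i))"

definition free_area :: "('a \<Rightarrow> bool) \<Rightarrow> nat \<times> (nat \<Rightarrow> 'a) \<Rightarrow> ennreal"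
  where "free_area D \<omega> = (\<integral>\<^sup>+v. of_bool (D v \<and> free D \<omega> v) \<partial>S)"

definition count_in :: "('a \<Rightarrow> bool) \<Rightarrow> nat \<times> (nat \<Rightarrow> 'a) \<Rightarrow> nat"
  where "count_in D \<omega> = card {i. i < fst \<omega> \<and> D (snd \<omega> i)}"

lemma point_measurable [measurable]: "(\<lambda>\<omega>. snd \<omega> i) \<in> measurable PP S"
  by measurable

lemma number_measurable [measurable]: "fst \<in> measurable PP (count_space UNIV)"
  by measurable

lemma compatible_measurable [measurable]: "Measurable.pred PP compatible"
  unfolding compatible_def by measurable

lemma count_in_measurable [measurable]:
  assumes [measurable]: "Measurable.pred S D"
  shows "count_in D \<in> measurable PP (count_space UNIV)"
  unfolding count_in_def by measurable

text \<open>
  The version with a parametrized region serves for integrals over the centre of the region.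
\<close>

lemma free_measurable_param:
  assumes D: "Measurable.pred (M \<Otimes>\<^sub>M S) (\<lambda>p. D (fst p) (snd p))"
    and [measurable]: "f \<in> measurable M PP" "g \<in> measurable M S"
  shows "Measurable.pred M (\<lambda>z. free (D z) (f z) (g z))"
proof -
  have pt [measurable]: "(\<lambda>z. snd (f z) i) \<in> measurable M S" for i
    by (rule measurable_compose[OF _ point_measurable]) fact
  have [measurable]: "(\<lambda>z. fst (f z)) \<in> measurable M (count_space UNIV)"
    by (rule measurable_compose[OF _ number_measurable]) fact
  have "(\<lambda>z. (z, snd (f z) i)) \<in> measurable M (M \<Otimes>\<^sub>M S)" for i by measurable
  from measurable_compose[OF this D]
  have [measurable]: "Measurable.pred M (\<lambda>z. D z (snd (f z) i))" for i by simp
  show ?thesis unfolding free_def by measurable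
qed

lemma free_area_measurable_param:
  assumes D: "Measurable.pred (M \<Otimes>\<^sub>M S) (\<lambda>p. D (fst p) (snd p))"
    and f: "f \<in> measurable M PP"
  shows "(\<lambda>z. free_area (D z) (f z)) \<in> borel_measurable M"
proof -
  have "(\<lambda>q. (fst (fst q), snd q)) \<in> measurable ((M \<Otimes>\<^sub>M S) \<Otimes>\<^sub>M S) (M \<Otimes>\<^sub>M S)" by measurable
  from measurable_compose[OF this D]
  have "Measurable.pred ((M \<Otimes>\<^sub>M S) \<Otimes>\<^sub>M S) (\<lambda>q. D (fst (fst q)) (snd q))" by simp
  from free_measurable_param[OF this measurable_compose[OF measurable_fst f] measurable_snd]
  have [measurable]: "Measurable.pred (M \<Otimes>\<^sub>M S) (\<lambda>p. free (D (fst p)) (f (fst p)) (snd p))" .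
  note D [measurable]
  have "(\<lambda>p. of_bool (D (fst p) (snd p) \<and> free (D (fst p)) (f (fst p)) (snd p)) :: ennreal)
      \<in> borel_measurable (M \<Otimes>\<^sub>M S)"
    by measurable
  then show ?thesis
    unfolding free_area_def by (intro borel_measurable_nn_integral) (simp add: case_prod_beta')
qed

lemma free_measurable [measurable (raw)]:
  assumes [measurable]: "Measurable.pred S D" and f: "f \<in> measurable M PP" "g \<in> measurable M S"
  shows "Measurable.pred M (\<lambda>z. free D (f z) (g z))"
  by (rule free_measurable_param[OF _ f]) measurable

lemma free_area_measurable [measurable (raw)]:
  assumes [measurable]: "Measurable.pred S D" and f: "f \<in> measurable M PP"
  shows "(\<lambda>z. free_area D (f z)) \<in> borel_measurable M"
  by (rule free_area_measurable_param[OF _ f]) measurable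

lemma free_K_measurable [measurable (raw)]:
  assumes [measurable]: "h \<in> measurable M S" and f: "f \<in> measurable M PP" "g \<in> measurable M S"
  shows "Measurable.pred M (\<lambda>z. free (K (h z)) (f z) (g z))"
  by (rule free_measurable_param[OF _ f]) measurable

lemma free_area_K_measurable [measurable (raw)]:
  assumes [measurable]: "h \<in> measurable M S" and f: "f \<in> measurable M PP"
  shows "(\<lambda>z. free_area (K (h z)) (f z)) \<in> borel_measurable M"
  by (rule free_area_measurable_param[OF _ f]) measurable

lemma free_area_le_1: "free_area D \<omega> \<le> 1"
proof -
  have "free_area D \<omega> \<le> (\<integral>\<^sup>+v. 1 \<partial>S)"
    unfolding free_area_def by (intro nn_integral_mono) auto
  then show ?thesis by (simp add: emeasure_space_1)
qed

lemma compatible_swap_first: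
  assumes "i < fst \<omega>" shows "compatible (swap_first i \<omega>) \<longleftrightarrow> compatible \<omega>"
proof -
  let ?t = "Transposition.transpose 0 i"
  have "compatible (swap_first i \<omega>) \<longleftrightarrow>
    (\<forall>j<fst \<omega>. \<forall>k<fst \<omega>. ?t j \<noteq> ?t k \<longrightarrow> \<not> K (snd \<omega> (?t j)) (snd \<omega> (?t k)))"
    unfolding compatible_def swap_first_def fst_conv snd_conv
    by (metis transpose_involutory)
  also have "\<dots> \<longleftrightarrow> (\<forall>j<fst \<omega>. \<forall>k<fst \<omega>. ?t j \<noteq> k \<longrightarrow> \<not> K (snd \<omega> (?t j)) (snd \<omega> k))"
    by (subst all_transpose[OF assms]) simp
  also have "\<dots> \<longleftrightarrow> compatible \<omega>"
    unfolding compatible_def by (subst all_transpose[OF assms]) simp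
  finally show ?thesis .
qed

lemma free_swap_first:
  assumes "i < fst \<omega>" shows "free D (swap_first i \<omega>) v \<longleftrightarrow> free D \<omega> v"
  unfolding free_def swap_first_def fst_conv snd_conv
  by (subst all_transpose[OF assms]) simp

lemma free_area_swap_first:
  "i < fst \<omega> \<Longrightarrow> free_area D (swap_first i \<omega>) = free_area D \<omega>"
  by (simp add: free_area_def free_swap_first)

lemma count_in_swap_first:
  assumes "i < fst \<omega>" shows "count_in D (swap_first i \<omega>) = count_in D \<omega>"
proof -
  let ?t = "Transposition.transpose 0 i"
  have lt: "j < fst \<omega> \<longleftrightarrow> ?t j < fst \<omega>" for j
    using assms by (auto simp: Transposition.transpose_def)
  have "{j. j < fst \<omega> \<and> D (snd \<omega> j)} = ?t ` {j. j < fst \<omega> \<and> D (snd \<omega> (?t j))}"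
    using lt by (auto simp: image_iff intro!: exI[of _ "?t _"])
  then have "count_in D \<omega> = card (?t ` {j. j < fst \<omega> \<and> D (snd \<omega> (?t j))})"
    by (simp add: count_in_def)
  also have "\<dots> = count_in D (swap_first i \<omega>)"
    unfolding count_in_def swap_first_def fst_conv snd_conv
    by (rule card_image) (auto intro!: inj_onI simp: transpose_eq_iff)
  finally show ?thesis ..
qed

lemma free_add_point: "free D (add_point u \<omega>) v \<longleftrightarrow> (\<not> D u \<longrightarrow> \<not> K v u) \<and> free D \<omega> v"
  unfolding free_def add_point_def by (auto simp: less_Suc_eq_0_disj)

lemma free_area_add_point: "D u \<Longrightarrow> free_area D (add_point u \<omega>) = free_area D \<omega>"
  by (simp add: free_area_def free_add_point)

lemma compatible_add_point:
  "compatible (add_point u \<omega>) \<longleftrightarrow> compatible \<omega> \<and> free (\<lambda>_. False) \<omega> u"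
  unfolding compatible_def free_def add_point_def using K_sym
  by (auto simp: less_Suc_eq_0_disj split: nat.splits)

lemma count_in_add_point: "count_in D (add_point u \<omega>) = of_bool (D u) + count_in D \<omega>"
proof -
  have "{i. i < Suc n \<and> D (case_nat u x i)} = (if D u then {0} else {}) \<union> Suc ` {i. i < n \<and> D (x i)}" for n x
    by (auto simp: less_Suc_eq_0_disj image_iff)
  moreover have "card (Suc ` {i. i < n \<and> D (x i)}) = card {i. i < n \<and> D (x i)}" for n x
    by (simp add: card_image)
  ultimately show ?thesis
    unfolding count_in_def add_point_def by (auto simp: card_insert_if)
qed

text \<open>
  The functionals of a configuration that depend on its points outside \<open>D\<close> only.
\<close>

definition insensitive :: "('a \<Rightarrow> bool) \<Rightarrow> (nat \<times> (nat \<Rightarrow> 'a) \<Rightarrow> ennreal) \<Rightarrow> bool"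
  where "insensitive D G \<longleftrightarrow> G \<in> borel_measurable PP \<and>
    (\<forall>\<omega>. \<forall>i<fst \<omega>. G (swap_first i \<omega>) = G \<omega>) \<and> (\<forall>u \<omega>. D u \<longrightarrow> G (add_point u \<omega>) = G \<omega>)"

lemma insensitive_mult: "insensitive D G \<Longrightarrow> insensitive D H \<Longrightarrow> insensitive D (\<lambda>\<omega>. G \<omega> * H \<omega>)"
  by (auto simp: insensitive_def)

lemma insensitive_free_area:
  "Measurable.pred S D \<Longrightarrow> f \<in> borel_measurable borel \<Longrightarrow> insensitive D (\<lambda>\<omega>. f (free_area D \<omega>))"
  by (auto simp: insensitive_def free_area_swap_first free_area_add_point)

lemma insensitive_free:
  assumes "Measurable.pred S D" "v \<in> space S" "\<And>u. E u \<Longrightarrow> D u"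
  shows "insensitive E (\<lambda>\<omega>. of_bool (D v \<and> free D \<omega> v))"
  using assms by (auto simp: insensitive_def free_swap_first free_add_point)

lemma count_in_sum: "of_nat (count_in D \<omega>) = (\<Sum>i<fst \<omega>. of_bool (D (snd \<omega> i)))"
proof -
  have "{i. i < fst \<omega> \<and> D (snd \<omega> i)} = {..<fst \<omega>} \<inter> {i. D (snd \<omega> i)}" by auto
  then show ?thesis by (simp add: count_in_def)
qed

definition level :: "('a \<Rightarrow> bool) \<Rightarrow> (nat \<times> (nat \<Rightarrow> 'a) \<Rightarrow> ennreal) \<Rightarrow> nat \<Rightarrow> ennreal"
  where "level D G k = (\<integral>\<^sup>+\<omega>. of_bool (compatible \<omega> \<and> count_in D \<omega> = k) * G \<omega> \<partial>PP)"

text \<open>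
  Apply the Mecke formula to the points in \<open>D\<close>. Removing one of the \<open>k + 1\<close> points leaves a
  configuration with \<open>k\<close> points in \<open>D\<close>, and the removed point is free, so that it ranges over a set
  of measure at most the free area; \<open>G\<close> and the free area do not notice the removal.
\<close>

lemma level_Suc_le:
  assumes D [measurable]: "Measurable.pred S D" and G: "insensitive D G"
  shows "of_nat (Suc k) * level D G (Suc k) \<le> ennreal lam * level D (\<lambda>\<omega>. G \<omega> * free_area D \<omega>) k"
proof -
  have [measurable]: "G \<in> borel_measurable PP" using G by (simp add: insensitive_def)
  define F where "F \<omega> = of_bool (D (snd \<omega> 0)) * (of_bool (compatible \<omega> \<and> count_in D \<omega> = Suc k) * G \<omega>)" for \<omega>
  have [measurable]: "F \<in> borel_measurable PP" unfolding F_def by measurable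
  have "of_nat (Suc k) * level D G (Suc k) =
      (\<integral>\<^sup>+\<omega>. of_nat (Suc k) * (of_bool (compatible \<omega> \<and> count_in D \<omega> = Suc k) * G \<omega>) \<partial>PP)"
    unfolding level_def by (rule nn_integral_cmult[symmetric]) measurable
  also have "\<dots> = (\<integral>\<^sup>+\<omega>. (\<Sum>i<fst \<omega>. F (swap_first i \<omega>)) \<partial>PP)"
  proof (intro nn_integral_cong)
    fix \<omega>
    have "(\<Sum>i<fst \<omega>. F (swap_first i \<omega>)) =
        (\<Sum>i<fst \<omega>. of_bool (D (snd \<omega> i)) * (of_bool (compatible \<omega> \<and> count_in D \<omega> = Suc k) * G \<omega>))"
      using G by (intro sum.cong)
        (auto simp: F_def compatible_swap_first count_in_swap_first insensitive_def, auto simp: swap_first_def)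
    also have "\<dots> = of_nat (count_in D \<omega>) * (of_bool (compatible \<omega> \<and> count_in D \<omega> = Suc k) * G \<omega>)"
      by (simp only: count_in_sum sum_distrib_right)
    finally show "of_nat (Suc k) * (of_bool (compatible \<omega> \<and> count_in D \<omega> = Suc k) * G \<omega>) =
        (\<Sum>i<fst \<omega>. F (swap_first i \<omega>))"
      by auto
  qed
  also have "\<dots> = ennreal lam * (\<integral>\<^sup>+\<omega>. \<integral>\<^sup>+u. F (add_point u \<omega>) \<partial>S \<partial>PP)"
    by (rule mecke) measurable
  also have "\<dots> \<le> ennreal lam * (\<integral>\<^sup>+\<omega>. \<integral>\<^sup>+u. of_bool (D u \<and> free D \<omega> u) *
      (of_bool (compatible \<omega> \<and> count_in D \<omega> = k) * G \<omega>) \<partial>S \<partial>PP)"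
  proof (intro mult_left_mono nn_integral_mono)
    fix \<omega> u
    have "G (add_point u \<omega>) = G \<omega>" if "D u" using G that unfolding insensitive_def by blast
    moreover have "snd (add_point u \<omega>) 0 = u" by (simp add: add_point_def)
    ultimately show "F (add_point u \<omega>) \<le> of_bool (D u \<and> free D \<omega> u) *
        (of_bool (compatible \<omega> \<and> count_in D \<omega> = k) * G \<omega>)"
      by (auto simp: F_def compatible_add_point count_in_add_point free_def)
  qed auto
  also have "\<dots> = ennreal lam * level D (\<lambda>\<omega>. G \<omega> * free_area D \<omega>) k"
    unfolding level_def
  proof (intro arg_cong2[where f = "(*)"] nn_integral_cong refl)
    fix \<omega> assume [measurable]: "\<omega> \<in> space PP"
    show "(\<integral>\<^sup>+u. of_bool (D u \<and> free D \<omega> u) *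
          (of_bool (compatible \<omega> \<and> count_in D \<omega> = k) * G \<omega>) \<partial>S) =
        of_bool (compatible \<omega> \<and> count_in D \<omega> = k) * (G \<omega> * free_area D \<omega>)"
      unfolding free_area_def by (subst nn_integral_multc) (simp_all add: mult_ac)
  qed
  finally show ?thesis .
qed

text \<open>
  Each application of the preceding estimate replaces the weight \<open>G\<close> by \<open>G * free_area D\<close>, which is
  again insensitive to \<open>D\<close>; hence the generalization over \<open>G\<close>.
\<close>

lemma level_le:
  assumes D [measurable]: "Measurable.pred S D" and G: "insensitive D G"
  shows "of_nat (fact k) * level D G k \<le> ennreal lam ^ k * level D (\<lambda>\<omega>. G \<omega> * free_area D \<omega> ^ k) 0"
  using G
proof (induction k arbitrary: G)
  case (Suc k)
  have "of_nat (fact (Suc k)) * level D G (Suc k) = of_nat (fact k) * (of_nat (Suc k) * level D G (Suc k))"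
    by (simp add: mult_ac distrib_left distrib_right)
  also have "\<dots> \<le> of_nat (fact k) * (ennreal lam * level D (\<lambda>\<omega>. G \<omega> * free_area D \<omega>) k)"
    by (intro mult_left_mono level_Suc_le Suc) auto
  also have "\<dots> = ennreal lam * (of_nat (fact k) * level D (\<lambda>\<omega>. G \<omega> * free_area D \<omega>) k)"
    by (simp add: mult_ac)
  also have "\<dots> \<le> ennreal lam * (ennreal lam ^ k * level D (\<lambda>\<omega>. (G \<omega> * free_area D \<omega>) * free_area D \<omega> ^ k) 0)"
    by (intro mult_left_mono Suc.IH insensitive_mult Suc.prems insensitive_free_area[where f = "\<lambda>x. x"]) auto
  finally show ?case by (simp add: mult_ac)
qed (simp add: level_def)

text \<open>
  Given the points outside \<open>D\<close>, the probability that \<open>D\<close> contains no point is at least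
  \<open>exp (- lam * a)\<close> with \<open>a\<close> the free area. Summing the estimate for \<open>k\<close> points in \<open>D\<close> over all \<open>k\<close>
  bounds the total weight by \<open>exp (lam * a)\<close> times the weight of the configurations without points
  in \<open>D\<close>. Taking the factor \<open>exp (- lam * a)\<close> into \<open>G\<close> beforehand makes this a statement about
  integrals, without conditional expectations.
\<close>

lemma void_lower_bound:
  assumes D [measurable]: "Measurable.pred S D" and G: "insensitive D G"
  shows "(\<integral>\<^sup>+\<omega>. of_bool (compatible \<omega>) * (G \<omega> * ennreal (exp (- lam * enn2real (free_area D \<omega>)))) \<partial>PP) \<le>
    (\<integral>\<^sup>+\<omega>. of_bool (compatible \<omega> \<and> count_in D \<omega> = 0) * G \<omega> \<partial>PP)"
proof -
  let ?a = "\<lambda>\<omega>. enn2real (free_area D \<omega>)"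
  define H where "H \<omega> = G \<omega> * ennreal (exp (- lam * ?a \<omega>))" for \<omega>
  have H: "insensitive D H"
    unfolding H_def by (intro insensitive_mult G insensitive_free_area[where f = "\<lambda>x. ennreal (exp (- lam * enn2real x))"]) auto
  then have [measurable]: "H \<in> borel_measurable PP" by (simp add: insensitive_def)
  have area: "ennreal (?a \<omega>) = free_area D \<omega>" for \<omega>
    by (rule ennreal_enn2real, rule le_less_trans[OF free_area_le_1]) simp
  have "(\<integral>\<^sup>+\<omega>. of_bool (compatible \<omega>) * H \<omega> \<partial>PP) =
      (\<integral>\<^sup>+\<omega>. (\<Sum>k. of_bool (compatible \<omega> \<and> count_in D \<omega> = k) * H \<omega>) \<partial>PP)"
  proof (intro nn_integral_cong)
    fix \<omega>
    have "(\<Sum>k. of_bool (compatible \<omega> \<and> count_in D \<omega> = k) * H \<omega>) =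
        (\<Sum>k. of_bool (count_in D \<omega> = k) * (of_bool (compatible \<omega>) * H \<omega>))"
      by (intro suminf_cong) auto
    also have "\<dots> = (\<Sum>k. of_bool (count_in D \<omega> = k)) * (of_bool (compatible \<omega>) * H \<omega>)"
      by (rule ennreal_suminf_multc)
    also have "\<dots> = of_bool (compatible \<omega>) * H \<omega>"
      by (simp only: suminf_of_bool_eq mult_1)
    finally show "of_bool (compatible \<omega>) * H \<omega> = (\<Sum>k. of_bool (compatible \<omega> \<and> count_in D \<omega> = k) * H \<omega>)"
      by (rule sym)
  qed
  also have "\<dots> = (\<Sum>k. level D H k)"
    unfolding level_def by (intro nn_integral_suminf) measurable
  also have "\<dots> \<le> (\<Sum>k. \<integral>\<^sup>+\<omega>. ennreal ((lam * ?a \<omega>) ^ k / fact k) *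
      (of_bool (compatible \<omega> \<and> count_in D \<omega> = 0) * H \<omega>) \<partial>PP)"
  proof (intro suminf_le summableI)
    fix k
    let ?c = "ennreal (1 / fact k)"
    have "?c * of_nat (fact k) = ennreal (1 / fact k) * ennreal (real (fact k))"
      by (simp only: ennreal_of_nat_eq_real_of_nat)
    also have "\<dots> = ennreal (1 / fact k * real (fact k))"
      by (intro ennreal_mult[symmetric]) auto
    finally have inv: "?c * of_nat (fact k) = 1"
      by simp
    have "level D H k = ?c * (of_nat (fact k) * level D H k)"
      by (simp only: mult.assoc[symmetric] inv) simp
    also have "\<dots> \<le> ?c * (ennreal lam ^ k * level D (\<lambda>\<omega>. H \<omega> * free_area D \<omega> ^ k) 0)"
      by (intro mult_left_mono level_le H) auto
    also have "\<dots> = (\<integral>\<^sup>+\<omega>. ?c * ennreal lam ^ k *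
        (of_bool (compatible \<omega> \<and> count_in D \<omega> = 0) * (H \<omega> * free_area D \<omega> ^ k)) \<partial>PP)"
      unfolding level_def by (subst nn_integral_cmult) (auto simp: mult.assoc)
    also have "\<dots> = (\<integral>\<^sup>+\<omega>. ennreal ((lam * ?a \<omega>) ^ k / fact k) *
      (of_bool (compatible \<omega> \<and> count_in D \<omega> = 0) * H \<omega>) \<partial>PP)"
    proof (intro nn_integral_cong)
      fix \<omega>
      have "(lam * ?a \<omega>) ^ k / fact k = 1 / fact k * lam ^ k * ?a \<omega> ^ k"
        by (simp add: power_mult_distrib)
      also have "ennreal \<dots> = ?c * ennreal (lam ^ k) * ennreal (?a \<omega> ^ k)"
        using lam_pos by (subst ennreal_mult, simp, simp, subst ennreal_mult) simp_all
      also have "\<dots> = ?c * ennreal lam ^ k * free_area D \<omega> ^ k"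
        using lam_pos by (simp add: ennreal_power[symmetric] area)
      finally show "?c * ennreal lam ^ k * (of_bool (compatible \<omega> \<and> count_in D \<omega> = 0) * (H \<omega> * free_area D \<omega> ^ k)) =
          ennreal ((lam * ?a \<omega>) ^ k / fact k) * (of_bool (compatible \<omega> \<and> count_in D \<omega> = 0) * H \<omega>)"
        by (simp add: mult_ac)
    qed
    finally show "level D H k \<le> \<dots>" .
  qed
  also have "\<dots> = (\<integral>\<^sup>+\<omega>. (\<Sum>k. ennreal ((lam * ?a \<omega>) ^ k / fact k) *
      (of_bool (compatible \<omega> \<and> count_in D \<omega> = 0) * H \<omega>)) \<partial>PP)"
    by (intro nn_integral_suminf[symmetric]) measurable
  also have "\<dots> = (\<integral>\<^sup>+\<omega>. of_bool (compatible \<omega> \<and> count_in D \<omega> = 0) * G \<omega> \<partial>PP)"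
  proof (intro nn_integral_cong)
    fix \<omega>
    have "(\<Sum>k. ennreal ((lam * ?a \<omega>) ^ k / fact k)) = ennreal (exp (lam * ?a \<omega>))"
      using lam_pos exp_converges[of "lam * ?a \<omega>"]
      by (intro suminf_ennreal_eq) (auto simp: divide_inverse mult.commute)
    moreover have "ennreal (exp (lam * ?a \<omega>)) * ennreal (exp (- lam * ?a \<omega>)) = 1"
      by (simp add: ennreal_mult[symmetric] exp_add[symmetric])
    ultimately show "(\<Sum>k. ennreal ((lam * ?a \<omega>) ^ k / fact k) *
        (of_bool (compatible \<omega> \<and> count_in D \<omega> = 0) * H \<omega>)) =
        of_bool (compatible \<omega> \<and> count_in D \<omega> = 0) * G \<omega>"
      unfolding ennreal_suminf_multc H_def by (simp add: mult_ac)
  qed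
  finally show ?thesis by (simp add: H_def)
qed

end

section \<open>Two opposing bounds for the mean number of points\<close>

context hard_core begin

text \<open>
  The probability that the Poisson process has no excluded pairs.
\<close>

definition weight :: ennreal
  where "weight = (\<integral>\<^sup>+\<omega>. of_bool (compatible \<omega>) \<partial>PP)"

definition weighted_size :: ennreal
  where "weighted_size = (\<integral>\<^sup>+\<omega>. of_bool (compatible \<omega>) * of_nat (fst \<omega>) \<partial>PP)"

lemma weight_le_1: "weight \<le> 1"
proof -
  have "weight \<le> (\<integral>\<^sup>+\<omega>. 1 \<partial>PP)" unfolding weight_def by (intro nn_integral_mono) auto
  then show ?thesis by (simp add: PP.emeasure_space_1)
qed

text \<open>
  The empty configuration alone has probability \<open>exp (- lam)\<close>.
\<close>

lemma weight_pos: "weight > 0"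
proof -
  have "0 < ennreal (exp (- lam))" by simp
  also have "ennreal (exp (- lam)) = (\<Sum>n\<in>{0}. ennreal (lam ^ n / fact n * exp (- lam)) *
      (\<integral>\<^sup>+x. of_bool (compatible (n, x)) \<partial>(\<Pi>\<^sub>M i\<in>UNIV. S)))"
    by (simp add: compatible_def seq.P.emeasure_space_1)
  also have "\<dots> \<le> (\<Sum>n. ennreal (lam ^ n / fact n * exp (- lam)) *
      (\<integral>\<^sup>+x. of_bool (compatible (n, x)) \<partial>(\<Pi>\<^sub>M i\<in>UNIV. S)))"
    by (rule sum_le_suminf) auto
  also have "\<dots> = weight"
    unfolding weight_def by (subst nn_integral_PP) auto
  finally show ?thesis .
qed

sublocale PP_S: pair_sigma_finite S PP ..

lemma count_in_eq_0_iff: "count_in (K u) \<omega> = 0 \<longleftrightarrow> free (\<lambda>_. False) \<omega> u"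
  by (auto simp: count_in_def free_def)

text \<open>
  A point \<open>u\<close> can be added to a configuration exactly if the configuration has no point in the
  region excluded by \<open>u\<close>.
\<close>

lemma weighted_size_eq_void:
  "weighted_size = ennreal lam * (\<integral>\<^sup>+u. \<integral>\<^sup>+\<omega>. of_bool (compatible \<omega> \<and> count_in (K u) \<omega> = 0) \<partial>PP \<partial>S)"
proof -
  have "weighted_size = (\<integral>\<^sup>+\<omega>. (\<Sum>i<fst \<omega>. of_bool (compatible (swap_first i \<omega>))) \<partial>PP)"
    unfolding weighted_size_def by (intro nn_integral_cong) (simp add: compatible_swap_first)
  also have "\<dots> = ennreal lam * (\<integral>\<^sup>+\<omega>. \<integral>\<^sup>+u. of_bool (compatible (add_point u \<omega>)) \<partial>S \<partial>PP)"
    by (rule mecke) measurable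
  also have "(\<integral>\<^sup>+\<omega>. \<integral>\<^sup>+u. of_bool (compatible (add_point u \<omega>)) \<partial>S \<partial>PP) =
      (\<integral>\<^sup>+u. \<integral>\<^sup>+\<omega>. of_bool (compatible (add_point u \<omega>)) \<partial>PP \<partial>S)"
    by (rule PP_S.Fubini') measurable
  finally show ?thesis by (simp add: compatible_add_point count_in_eq_0_iff)
qed

lemma nn_integral_of_bool_le_1: "(\<integral>\<^sup>+v. of_bool (P v) \<partial>S) \<le> 1"
proof -
  have "(\<integral>\<^sup>+v. of_bool (P v) \<partial>S) \<le> (\<integral>\<^sup>+v. 1 \<partial>S)" by (intro nn_integral_mono) auto
  then show ?thesis by (simp add: emeasure_space_1)
qed

lemma ennreal_enn2real_free_area: "ennreal (enn2real (free_area D \<omega>)) = free_area D \<omega>"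
  by (rule ennreal_enn2real, rule le_less_trans[OF free_area_le_1]) simp

text \<open>
  For a fixed centre \<open>u\<close> the right-hand side is, up to the factor \<open>lam\<close>, the weighted number of
  points in the region \<open>K u\<close>. A point \<open>y\<close> of that region can be added if it is free with respect to
  \<open>K u\<close> and if \<open>K u \<inter> K y\<close> is void. The void estimate for \<open>K u \<inter> K y\<close> costs at most
  \<open>exp (- lam * nb y)\<close>, where \<open>nb y\<close> is the measure of the free part of \<open>K u\<close> that \<open>y\<close> excludes, and
  the average of \<open>nb\<close> over the free part of \<open>K u\<close> is at most \<open>r\<close>.
\<close>

lemma mean_count_lower_bound:
  fixes r :: real
  assumes u [measurable]: "u \<in> space S"
    and r: "\<And>T. Measurable.pred S T \<Longrightarrow> (\<And>v. T v \<Longrightarrow> K u v) \<Longrightarrow>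
      (\<integral>\<^sup>+v. of_bool (T v) * (\<integral>\<^sup>+v'. of_bool (T v' \<and> K v v') \<partial>S) \<partial>S) \<le> ennreal r * (\<integral>\<^sup>+v. of_bool (T v) \<partial>S)"
    and r_nonneg: "0 \<le> r"
  shows "ennreal (exp (- (lam * r))) * (\<integral>\<^sup>+\<omega>. of_bool (compatible \<omega>) * free_area (K u) \<omega> \<partial>PP) \<le>
    (\<integral>\<^sup>+y. \<integral>\<^sup>+\<omega>. of_bool (K u y \<and> compatible (add_point y \<omega>)) \<partial>PP \<partial>S)"
proof -
  define T where "T \<omega> y \<longleftrightarrow> K u y \<and> free (K u) \<omega> y" for \<omega> y
  define nb where "nb \<omega> y = (\<integral>\<^sup>+v. of_bool (T \<omega> v \<and> K y v) \<partial>S)" for \<omega> y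
  have T_meas [measurable (raw)]: "Measurable.pred M (\<lambda>z. T (f z) (g z))"
    if [measurable]: "f \<in> measurable M PP" "g \<in> measurable M S" for f g and M :: "'c measure"
    unfolding T_def by measurable
  have [measurable]: "(\<lambda>p. nb (fst p) (snd p)) \<in> borel_measurable (PP \<Otimes>\<^sub>M S)"
    unfolding nb_def by measurable
  have "(\<lambda>p. nb (snd p) (fst p)) \<in> borel_measurable (S \<Otimes>\<^sub>M PP)"
    unfolding nb_def by measurable
  note [measurable] = this
  have nb_le: "nb \<omega> y \<le> 1" for \<omega> y unfolding nb_def by (rule nn_integral_of_bool_le_1)
  have nb_eq: "ennreal (enn2real (nb \<omega> y)) = nb \<omega> y" for \<omega> y
    by (rule ennreal_enn2real, rule le_less_trans[OF nb_le]) simp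
  have "ennreal (exp (- (lam * r))) * (\<integral>\<^sup>+\<omega>. of_bool (compatible \<omega>) * free_area (K u) \<omega> \<partial>PP) =
      (\<integral>\<^sup>+\<omega>. of_bool (compatible \<omega>) * (ennreal (exp (- (lam * r))) * (\<integral>\<^sup>+y. of_bool (T \<omega> y) \<partial>S)) \<partial>PP)"
    by (subst nn_integral_cmult[symmetric]) (simp_all add: T_def free_area_def mult_ac)
  also have "\<dots> \<le> (\<integral>\<^sup>+\<omega>. of_bool (compatible \<omega>) *
      (\<integral>\<^sup>+y. of_bool (T \<omega> y) * ennreal (exp (- (lam * enn2real (nb \<omega> y)))) \<partial>S) \<partial>PP)"
  proof (intro nn_integral_mono mult_left_mono jensen_exp_nn_integral)
    fix \<omega> assume [measurable]: "\<omega> \<in> space PP"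
    show "(\<lambda>y. of_bool (T \<omega> y) :: ennreal) \<in> borel_measurable S" by measurable
    have [measurable]: "nb \<omega> \<in> borel_measurable S" unfolding nb_def by measurable
    show "(\<lambda>y. lam * enn2real (nb \<omega> y)) \<in> borel_measurable S" by measurable
    have "(\<integral>\<^sup>+y. of_bool (T \<omega> y) * ennreal (lam * enn2real (nb \<omega> y)) \<partial>S) =
        ennreal lam * (\<integral>\<^sup>+y. of_bool (T \<omega> y) * nb \<omega> y \<partial>S)"
      using lam_pos by (subst nn_integral_cmult[symmetric]) (simp_all add: ennreal_mult nb_eq mult_ac)
    also have "\<dots> \<le> ennreal lam * (ennreal r * (\<integral>\<^sup>+y. of_bool (T \<omega> y) \<partial>S))"
      unfolding nb_def by (intro mult_left_mono r) (auto simp: T_def)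
    also have "\<dots> = ennreal (lam * r) * (\<integral>\<^sup>+y. of_bool (T \<omega> y) \<partial>S)"
      using lam_pos r_nonneg by (simp add: ennreal_mult mult.assoc)
    finally show "(\<integral>\<^sup>+y. of_bool (T \<omega> y) * ennreal (lam * enn2real (nb \<omega> y)) \<partial>S) \<le> \<dots>" .
    show "(\<integral>\<^sup>+y. of_bool (T \<omega> y) \<partial>S) < \<infinity>"
      by (rule le_less_trans[OF nn_integral_of_bool_le_1]) simp
  qed (use lam_pos r_nonneg in auto)
  also have "\<dots> = (\<integral>\<^sup>+\<omega>. \<integral>\<^sup>+y. of_bool (compatible \<omega>) *
      (of_bool (T \<omega> y) * ennreal (exp (- (lam * enn2real (nb \<omega> y))))) \<partial>S \<partial>PP)"
    by (intro nn_integral_cong nn_integral_cmult[symmetric]) (unfold nb_def, measurable)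
  also have "\<dots> = (\<integral>\<^sup>+y. \<integral>\<^sup>+\<omega>. of_bool (compatible \<omega>) *
      (of_bool (T \<omega> y) * ennreal (exp (- (lam * enn2real (nb \<omega> y))))) \<partial>PP \<partial>S)"
    by (rule PP_S.Fubini') (simp add: case_prod_beta')
  also have "\<dots> \<le> (\<integral>\<^sup>+y. \<integral>\<^sup>+\<omega>. of_bool (K u y \<and> compatible (add_point y \<omega>)) \<partial>PP \<partial>S)"
  proof (rule nn_integral_mono)
    fix y assume y [measurable]: "y \<in> space S"
    \<comment> \<open>The points in the region of \<open>u\<close> that prevent \<open>y\<close> from being added; the points outside \<open>K u\<close> are taken care of by \<open>T\<close>.\<close>
    define D where "D v \<longleftrightarrow> K u v \<and> K y v" for v
    have [measurable]: "Measurable.pred S D" unfolding D_def by measurable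
    have "(\<integral>\<^sup>+\<omega>. of_bool (compatible \<omega>) * (of_bool (T \<omega> y) * ennreal (exp (- (lam * enn2real (nb \<omega> y))))) \<partial>PP)
      \<le> (\<integral>\<^sup>+\<omega>. of_bool (compatible \<omega>) * (of_bool (T \<omega> y) * ennreal (exp (- lam * enn2real (free_area D \<omega>)))) \<partial>PP)"
    proof (intro nn_integral_mono mult_left_mono)
      fix \<omega>
      have "free_area D \<omega> \<le> nb \<omega> y"
        unfolding free_area_def nb_def D_def T_def free_def by (intro nn_integral_mono) auto
      then have "enn2real (free_area D \<omega>) \<le> enn2real (nb \<omega> y)"
        by (intro enn2real_mono) (use le_less_trans[OF nb_le, of top] in auto)
      then show "ennreal (exp (- (lam * enn2real (nb \<omega> y)))) \<le> ennreal (exp (- lam * enn2real (free_area D \<omega>)))"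
        using lam_pos by (intro ennreal_leI) auto
    qed auto
    also have "\<dots> \<le> (\<integral>\<^sup>+\<omega>. of_bool (compatible \<omega> \<and> count_in D \<omega> = 0) * of_bool (T \<omega> y) \<partial>PP)"
      unfolding T_def by (intro void_lower_bound insensitive_free y) (auto simp: D_def)
    also have "\<dots> \<le> (\<integral>\<^sup>+\<omega>. of_bool (K u y \<and> compatible (add_point y \<omega>)) \<partial>PP)"
      by (intro nn_integral_mono)
         (auto simp: T_def D_def count_in_def free_def compatible_add_point)
    finally show "(\<integral>\<^sup>+\<omega>. of_bool (compatible \<omega>) * (of_bool (T \<omega> y) * ennreal (exp (- (lam * enn2real (nb \<omega> y))))) \<partial>PP)
      \<le> \<dots>" .
  qed
  finally show ?thesis .
qed

text \<open>
  The number \<open>z\<close> is \<open>lam\<close> times the mean free area of the region around a random centre. The first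
  bound is the void estimate for that region. For the second, \<open>weighted_size * p\<close> dominates the mean
  number of points in the region around a random centre, since each point is in the region of a set
  of centres of measure at most \<open>p\<close>.
\<close>

lemma weighted_size_bounds:
  fixes p r :: real
  assumes p: "\<And>u. u \<in> space S \<Longrightarrow> (\<integral>\<^sup>+v. of_bool (K v u) \<partial>S) \<le> ennreal p"
    and r: "\<And>u T. u \<in> space S \<Longrightarrow> Measurable.pred S T \<Longrightarrow> (\<And>v. T v \<Longrightarrow> K u v) \<Longrightarrow>
      (\<integral>\<^sup>+v. of_bool (T v) * (\<integral>\<^sup>+v'. of_bool (T v' \<and> K v v') \<partial>S) \<partial>S) \<le> ennreal r * (\<integral>\<^sup>+v. of_bool (T v) \<partial>S)"
    and r_nonneg: "0 \<le> r"
  shows "\<exists>z\<ge>0. ennreal (lam * exp (- z)) * weight \<le> weighted_size \<and>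
    ennreal (z * exp (- lam * r)) * weight \<le> weighted_size * ennreal p"
proof -
  define Z where "Z = (\<integral>\<^sup>+u. \<integral>\<^sup>+\<omega>. of_bool (compatible \<omega>) * free_area (K u) \<omega> \<partial>PP \<partial>S)"
  define z where "z = lam * enn2real (Z / weight)"
  have Z_le: "Z \<le> weight"
  proof -
    have "Z \<le> (\<integral>\<^sup>+u. \<integral>\<^sup>+\<omega>. of_bool (compatible \<omega>) * 1 \<partial>PP \<partial>S)"
      unfolding Z_def by (intro nn_integral_mono mult_left_mono free_area_le_1) auto
    then show ?thesis by (simp add: weight_def emeasure_space_1)
  qed
  have wt: "weight \<noteq> 0" "weight \<noteq> top"
    using weight_pos weight_le_1 by (auto simp: top_unique)
  have "Z / weight \<noteq> top"
    using wt Z_le by (auto simp: ennreal_divide_eq_top_iff top_unique)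
  then have Z_eq: "ennreal z * weight = ennreal lam * Z"
    unfolding z_def using lam_pos wt
    by (subst ennreal_mult) (auto simp: mult.assoc ennreal_divide_times less_top intro!: ennreal_times_divide[symmetric])
  have z: "0 \<le> z" unfolding z_def using lam_pos by simp
  interpret S_S: pair_sigma_finite S S ..
  define F where "F \<omega> = of_bool (compatible \<omega>) * (\<integral>\<^sup>+u. of_bool (K u (snd \<omega> 0)) \<partial>S)" for \<omega>
  show ?thesis
  proof (intro exI[of _ z] conjI z)
    have fin: "(\<integral>\<^sup>+p. of_bool (compatible (snd p)) \<partial>(S \<Otimes>\<^sub>M PP)) = weight"
      by (subst PP.nn_integral_fst[symmetric]) (simp_all add: weight_def emeasure_space_1)
    have "(\<integral>\<^sup>+p. of_bool (compatible (snd p)) * ennreal (lam * enn2real (free_area (K (fst p)) (snd p))) \<partial>(S \<Otimes>\<^sub>M PP)) =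
        (\<integral>\<^sup>+u. \<integral>\<^sup>+\<omega>. ennreal lam * (of_bool (compatible \<omega>) * free_area (K u) \<omega>) \<partial>PP \<partial>S)"
      using lam_pos
      by (subst PP.nn_integral_fst[symmetric])
         (simp_all add: ennreal_mult ennreal_enn2real_free_area mult.left_commute)
    also have "\<dots> = (\<integral>\<^sup>+u. ennreal lam * (\<integral>\<^sup>+\<omega>. of_bool (compatible \<omega>) * free_area (K u) \<omega> \<partial>PP) \<partial>S)"
      by (intro nn_integral_cong nn_integral_cmult) measurable
    also have "\<dots> = ennreal lam * Z"
      unfolding Z_def by (rule nn_integral_cmult) measurable
    finally have "(\<integral>\<^sup>+p. of_bool (compatible (snd p)) * ennreal (lam * enn2real (free_area (K (fst p)) (snd p))) \<partial>(S \<Otimes>\<^sub>M PP)) =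
        ennreal lam * Z" .
    then have "ennreal (exp (- z)) * weight \<le> (\<integral>\<^sup>+p. of_bool (compatible (snd p)) *
        ennreal (exp (- (lam * enn2real (free_area (K (fst p)) (snd p))))) \<partial>(S \<Otimes>\<^sub>M PP))"
      using jensen_exp_nn_integral[of "\<lambda>p. of_bool (compatible (snd p))" "S \<Otimes>\<^sub>M PP"
          "\<lambda>p. lam * enn2real (free_area (K (fst p)) (snd p))" z] wt z lam_pos
      by (simp add: fin Z_eq less_top[symmetric])
    also have "\<dots> = (\<integral>\<^sup>+u. \<integral>\<^sup>+\<omega>. of_bool (compatible \<omega>) * (1 * ennreal (exp (- lam * enn2real (free_area (K u) \<omega>)))) \<partial>PP \<partial>S)"
      by (subst PP.nn_integral_fst[symmetric]) simp_all
    also have "\<dots> \<le> (\<integral>\<^sup>+u. \<integral>\<^sup>+\<omega>. of_bool (compatible \<omega> \<and> count_in (K u) \<omega> = 0) * 1 \<partial>PP \<partial>S)"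
      by (intro nn_integral_mono void_lower_bound) (auto simp: insensitive_def)
    finally have "ennreal lam * (ennreal (exp (- z)) * weight) \<le> weighted_size"
      unfolding weighted_size_eq_void by (intro mult_left_mono) simp_all
    then show "ennreal (lam * exp (- z)) * weight \<le> weighted_size"
      using lam_pos by (simp add: ennreal_mult mult.assoc)
    have "ennreal (z * exp (- lam * r)) * weight = ennreal (exp (- (lam * r))) * (ennreal z * weight)"
      using z by (simp add: ennreal_mult mult_ac)
    also have "\<dots> = ennreal lam * (ennreal (exp (- (lam * r))) * Z)"
      unfolding Z_eq by (simp add: mult_ac)
    also have "ennreal (exp (- (lam * r))) * Z =
        (\<integral>\<^sup>+u. ennreal (exp (- (lam * r))) * (\<integral>\<^sup>+\<omega>. of_bool (compatible \<omega>) * free_area (K u) \<omega> \<partial>PP) \<partial>S)"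
      unfolding Z_def by (rule nn_integral_cmult[symmetric]) measurable
    also have "\<dots> \<le> (\<integral>\<^sup>+u. \<integral>\<^sup>+y. \<integral>\<^sup>+\<omega>. of_bool (K u y \<and> compatible (add_point y \<omega>)) \<partial>PP \<partial>S \<partial>S)"
      by (intro nn_integral_mono mean_count_lower_bound r r_nonneg)
    also have "\<dots> = (\<integral>\<^sup>+u. \<integral>\<^sup>+\<omega>. \<integral>\<^sup>+y. of_bool (K u y \<and> compatible (add_point y \<omega>)) \<partial>S \<partial>PP \<partial>S)"
      by (intro nn_integral_cong PP_S.Fubini'[symmetric]) measurable
    also have "\<dots> = (\<integral>\<^sup>+\<omega>. \<integral>\<^sup>+u. \<integral>\<^sup>+y. of_bool (K u y \<and> compatible (add_point y \<omega>)) \<partial>S \<partial>S \<partial>PP)"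
      by (intro PP_S.Fubini'[symmetric]) measurable
    also have "\<dots> = (\<integral>\<^sup>+\<omega>. \<integral>\<^sup>+y. \<integral>\<^sup>+u. of_bool (K u y \<and> compatible (add_point y \<omega>)) \<partial>S \<partial>S \<partial>PP)"
      by (intro nn_integral_cong S_S.Fubini') measurable
    finally have "ennreal (z * exp (- lam * r)) * weight \<le>
        ennreal lam * (\<integral>\<^sup>+\<omega>. \<integral>\<^sup>+y. \<integral>\<^sup>+u. of_bool (K u y \<and> compatible (add_point y \<omega>)) \<partial>S \<partial>S \<partial>PP)"
      by (simp add: mult_left_mono)
    also have "\<dots> = ennreal lam * (\<integral>\<^sup>+\<omega>. \<integral>\<^sup>+y. F (add_point y \<omega>) \<partial>S \<partial>PP)"
    proof (intro arg_cong2[where f = "(*)"] nn_integral_cong refl)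
      fix \<omega> y assume [measurable]: "y \<in> space S"
      have "snd (add_point y \<omega>) 0 = y" by (simp add: add_point_def)
      then show "(\<integral>\<^sup>+u. of_bool (K u y \<and> compatible (add_point y \<omega>)) \<partial>S) = F (add_point y \<omega>)"
        unfolding F_def by (cases "compatible (add_point y \<omega>)") simp_all
    qed
    also have "\<dots> = (\<integral>\<^sup>+\<omega>. (\<Sum>i<fst \<omega>. F (swap_first i \<omega>)) \<partial>PP)"
      unfolding F_def by (rule mecke[symmetric]) measurable
    also have "\<dots> \<le> (\<integral>\<^sup>+\<omega>. of_bool (compatible \<omega>) * of_nat (fst \<omega>) * ennreal p \<partial>PP)"
    proof (intro nn_integral_mono)
      fix \<omega> assume \<omega>: "\<omega> \<in> space PP"
      have "(\<Sum>i<fst \<omega>. F (swap_first i \<omega>)) \<le> (\<Sum>i<fst \<omega>. of_bool (compatible \<omega>) * ennreal p)"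
      proof (intro sum_mono)
        fix i assume "i \<in> {..<fst \<omega>}"
        then have "F (swap_first i \<omega>) = of_bool (compatible \<omega>) * (\<integral>\<^sup>+u. of_bool (K u (snd \<omega> i)) \<partial>S)"
          unfolding F_def by (simp add: compatible_swap_first) (simp add: swap_first_def)
        also have "\<dots> \<le> of_bool (compatible \<omega>) * ennreal p"
          by (intro mult_left_mono p snd_PP_in_space \<omega>) simp
        finally show "F (swap_first i \<omega>) \<le> of_bool (compatible \<omega>) * ennreal p" .
      qed
      then show "(\<Sum>i<fst \<omega>. F (swap_first i \<omega>)) \<le> of_bool (compatible \<omega>) * of_nat (fst \<omega>) * ennreal p"
        by (simp add: mult_ac)
    qed
    also have "\<dots> = weighted_size * ennreal p"
      unfolding weighted_size_def by (rule nn_integral_multc) measurable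
    finally show "ennreal (z * exp (- lam * r)) * weight \<le> weighted_size * ennreal p" .
  qed
qed

definition mean_size :: real
  where "mean_size = enn2real (weighted_size / weight)"

lemma weighted_size_le: "weighted_size \<le> ennreal lam"
proof -
  have "(\<integral>\<^sup>+u. \<integral>\<^sup>+\<omega>. of_bool (compatible \<omega> \<and> count_in (K u) \<omega> = 0) \<partial>PP \<partial>S) \<le> (\<integral>\<^sup>+u. \<integral>\<^sup>+\<omega>. 1 \<partial>PP \<partial>S)"
    by (intro nn_integral_mono) auto
  then have "(\<integral>\<^sup>+u. \<integral>\<^sup>+\<omega>. of_bool (compatible \<omega> \<and> count_in (K u) \<omega> = 0) \<partial>PP \<partial>S) \<le> 1"
    by (simp add: PP.emeasure_space_1 emeasure_space_1)
  from mult_left_mono[OF this, of "ennreal lam"] show ?thesis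
    unfolding weighted_size_eq_void by simp
qed

lemma weighted_size_eq_mean: "weighted_size = ennreal mean_size * weight"
proof -
  have wt: "weight \<noteq> 0" "weight \<noteq> top"
    using weight_pos weight_le_1 by (auto simp: top_unique)
  have "weighted_size / weight \<noteq> top"
    using wt weighted_size_le by (auto simp: ennreal_divide_eq_top_iff top_unique)
  then show ?thesis
    unfolding mean_size_def using wt
    by (simp add: ennreal_divide_times less_top[symmetric] ennreal_times_divide[symmetric])
qed

lemma mean_size_nonneg: "0 \<le> mean_size" by (simp add: mean_size_def)

theorem mean_size_bounds:
  fixes p r :: real
  assumes p: "\<And>u. u \<in> space S \<Longrightarrow> (\<integral>\<^sup>+v. of_bool (K v u) \<partial>S) \<le> ennreal p" and "0 \<le> p"
    and r: "\<And>u T. u \<in> space S \<Longrightarrow> Measurable.pred S T \<Longrightarrow> (\<And>v. T v \<Longrightarrow> K u v) \<Longrightarrow>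
      (\<integral>\<^sup>+v. of_bool (T v) * (\<integral>\<^sup>+v'. of_bool (T v' \<and> K v v') \<partial>S) \<partial>S) \<le> ennreal r * (\<integral>\<^sup>+v. of_bool (T v) \<partial>S)"
    and "0 \<le> r"
  obtains z where "0 \<le> z" "lam * exp (- z) \<le> mean_size" "z * exp (- lam * r) \<le> mean_size * p"
proof -
  have "\<exists>z\<ge>0. ennreal (lam * exp (- z)) * weight \<le> weighted_size \<and>
      ennreal (z * exp (- lam * r)) * weight \<le> weighted_size * ennreal p"
    by (rule weighted_size_bounds) (fact p, fact r, fact)
  then obtain z where z: "0 \<le> z" and
    *: "ennreal (lam * exp (- z)) * weight \<le> weighted_size"
       "ennreal (z * exp (- lam * r)) * weight \<le> weighted_size * ennreal p"
    by blast
  have wt: "weight \<noteq> 0" "weight \<noteq> top"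
    using weight_pos weight_le_1 by (auto simp: top_unique)
  have cancel: "x \<le> y" if "ennreal x * weight \<le> ennreal y * weight" "0 \<le> y" for x y
  proof -
    have "weight * ennreal x \<le> weight * ennreal y" using that(1) by (simp add: mult.commute)
    then have "ennreal x \<le> ennreal y"
      using wt by (subst (asm) ennreal_mult_le_mult_iff) auto
    then show "x \<le> y" using that(2) by (simp add: ennreal_le_iff)
  qed
  show ?thesis
  proof (rule that[OF z])
    from *(1) have "ennreal (lam * exp (- z)) * weight \<le> ennreal mean_size * weight"
      by (simp only: weighted_size_eq_mean)
    then show "lam * exp (- z) \<le> mean_size"
      by (rule cancel) (rule mean_size_nonneg)
    have "weighted_size * ennreal p = ennreal (mean_size * p) * weight"
      unfolding weighted_size_eq_mean ennreal_mult[OF mean_size_nonneg \<open>0 \<le> p\<close>]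
      by (simp only: mult_ac)
    with *(2) have "ennreal (z * exp (- lam * r)) * weight \<le> ennreal (mean_size * p) * weight"
      by (simp only:)
    then show "z * exp (- lam * r) \<le> mean_size * p"
      by (rule cancel) (use mean_size_nonneg \<open>0 \<le> p\<close> in simp)
  qed
qed

end

section \<open>Monotonicity in the intensity\<close>

lemma summable_poisson_mean: "summable (\<lambda>n. real n * (x ^ n / fact n :: real))"
proof -
  have "summable (\<lambda>n. x * (x ^ n / fact n))"
    using summable_exp[of x] by (intro summable_mult) (simp add: field_simps)
  moreover have "x * (x ^ n / fact n) = real (Suc n) * (x ^ Suc n / fact (Suc n))" for n
    by (simp add: divide_simps del: of_nat_Suc)
  ultimately have "summable (\<lambda>n. real (Suc n) * (x ^ Suc n / fact (Suc n)))" by simp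
  then show ?thesis by (subst (asm) summable_Suc_iff)
qed

text \<open>
  Raising the parameter from \<open>s\<close> to \<open>t\<close> multiplies the weight of \<open>n\<close> by \<open>q ^ n\<close> with \<open>q = t / s \<ge> 1\<close>.
  As \<open>n - m\<close> and \<open>q ^ n - q powr m\<close> have the same sign, \<open>(n - m) * q ^ n \<ge> (n - m) * q powr m\<close>, and the
  right-hand side has mean zero under the old weights when \<open>m\<close> is the old mean.
\<close>

lemma tilted_mean_mono:
  fixes a :: "nat \<Rightarrow> real"
  assumes a: "\<And>n. 0 \<le> a n" "\<And>n. a n \<le> 1" and st: "0 < s" "s \<le> t"
    and m: "(\<Sum>n. real n * (s ^ n / fact n) * a n) = m * (\<Sum>n. s ^ n / fact n * a n)"
  shows "m * (\<Sum>n. t ^ n / fact n * a n) \<le> (\<Sum>n. real n * (t ^ n / fact n) * a n)"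
proof -
  have sm0: "summable (\<lambda>n. x ^ n / fact n * a n)" if "0 < x" for x
    by (rule summable_comparison_test'[where N = 0 and g = "\<lambda>n. x ^ n / fact n"])
       (use summable_exp[of x] a that in \<open>auto simp: field_simps mult_left_le\<close>)
  have sm1: "summable (\<lambda>n. real n * (x ^ n / fact n) * a n)" if "0 < x" for x
  proof (rule summable_comparison_test'[OF summable_poisson_mean])
    fix n :: nat
    have "real n * (x ^ n / fact n) * a n \<le> real n * (x ^ n / fact n)"
      using a that by (intro mult_left_le) auto
    moreover have "0 \<le> real n * (x ^ n / fact n) * a n"
      using a that by (intro mult_nonneg_nonneg divide_nonneg_nonneg) auto
    ultimately show "norm (real n * (x ^ n / fact n) * a n) \<le> real n * (x ^ n / fact n)"
      by (simp only: real_norm_def abs_of_nonneg)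
  qed
  have sd: "(\<Sum>n. (real n - m) * (x ^ n / fact n * a n)) =
      (\<Sum>n. real n * (x ^ n / fact n) * a n) - m * (\<Sum>n. x ^ n / fact n * a n)"
    and sd': "summable (\<lambda>n. (real n - m) * (x ^ n / fact n * a n))" if "0 < x" for x
  proof -
    have eq: "(real n - m) * (x ^ n / fact n * a n) = real n * (x ^ n / fact n) * a n - m * (x ^ n / fact n * a n)" for n
      by (simp only: left_diff_distrib mult.assoc)
    show "(\<Sum>n. (real n - m) * (x ^ n / fact n * a n)) =
      (\<Sum>n. real n * (x ^ n / fact n) * a n) - m * (\<Sum>n. x ^ n / fact n * a n)"
      unfolding eq suminf_mult[OF sm0[OF that], symmetric]
      by (rule suminf_diff[symmetric]) (intro sm0[OF that] sm1[OF that] summable_mult)+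
    show "summable (\<lambda>n. (real n - m) * (x ^ n / fact n * a n))"
      unfolding eq using sm0[OF that] sm1[OF that] by (intro summable_diff summable_mult)
  qed
  define q where "q = t / s"
  have q: "1 \<le> q" "0 < q" using st by (auto simp: q_def)
  have "0 = q powr m * (\<Sum>n. (real n - m) * (s ^ n / fact n * a n))"
    using sd[OF st(1)] m by simp
  also have "\<dots> = (\<Sum>n. q powr m * ((real n - m) * (s ^ n / fact n * a n)))"
    by (intro suminf_mult[symmetric] sd' st)
  also have "\<dots> \<le> (\<Sum>n. (real n - m) * (t ^ n / fact n * a n))"
  proof (intro suminf_le summable_mult sd')
    fix n
    have "q powr m * (real n - m) \<le> q ^ n * (real n - m)"
    proof (cases "m \<le> real n")
      case True
      then have "q powr m \<le> q powr real n" using q by (intro powr_mono) auto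
      then show ?thesis using True q by (intro mult_right_mono) (auto simp: powr_realpow)
    next
      case False
      then have "q powr real n \<le> q powr m" using q by (intro powr_mono) auto
      then show ?thesis using False q by (intro mult_right_mono_neg) (auto simp: powr_realpow)
    qed
    then have "q powr m * (real n - m) * (s ^ n / fact n * a n) \<le> q ^ n * (real n - m) * (s ^ n / fact n * a n)"
      by (rule mult_right_mono) (use a st in simp)
    also have "\<dots> = (real n - m) * (q ^ n * s ^ n / fact n * a n)" by simp
    also have "q ^ n * s ^ n = t ^ n" using st by (simp add: q_def power_divide)
    finally show "q powr m * ((real n - m) * (s ^ n / fact n * a n)) \<le> (real n - m) * (t ^ n / fact n * a n)"
      by (simp only: mult.assoc)
  qed (use st in auto)
  also have "\<dots> = (\<Sum>n. real n * (t ^ n / fact n) * a n) - m * (\<Sum>n. t ^ n / fact n * a n)"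
    using st by (intro sd) auto
  finally show ?thesis by simp
qed

context hard_core begin

lemma compatible_nn_integral_le_1: "(\<integral>\<^sup>+x. of_bool (compatible (n, x)) \<partial>(\<Pi>\<^sub>M i\<in>UNIV. S)) \<le> 1"
proof -
  have "(\<integral>\<^sup>+x. of_bool (compatible (n, x)) \<partial>(\<Pi>\<^sub>M i\<in>UNIV. S)) \<le> (\<integral>\<^sup>+x. 1 \<partial>(\<Pi>\<^sub>M i\<in>(UNIV :: nat set). S))"
    by (intro nn_integral_mono) auto
  then show ?thesis by (simp add: seq.P.emeasure_space_1)
qed

text \<open>
  The probability that \<open>n\<close> independent points have no excluded pair. It does not depend on \<open>lam\<close>, so
  the mean size is the mean of a family of weights to which \<open>tilted_mean_mono\<close> applies.
\<close>

definition compatible_prob :: "nat \<Rightarrow> real"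
  where "compatible_prob n = enn2real (\<integral>\<^sup>+x. of_bool (compatible (n, x)) \<partial>(\<Pi>\<^sub>M i\<in>UNIV. S))"

lemma compatible_prob: "0 \<le> compatible_prob n" "compatible_prob n \<le> 1"
  using enn2real_mono[OF compatible_nn_integral_le_1, of n] by (auto simp: compatible_prob_def)

lemma ennreal_compatible_prob:
  "ennreal (compatible_prob n) = (\<integral>\<^sup>+x. of_bool (compatible (n, x)) \<partial>(\<Pi>\<^sub>M i\<in>UNIV. S))"
  unfolding compatible_prob_def
  by (rule ennreal_enn2real, rule le_less_trans[OF compatible_nn_integral_le_1]) simp

lemma summable_weight: "summable (\<lambda>n. lam ^ n / fact n * compatible_prob n)"
  by (rule summable_comparison_test'[where N = 0 and g = "\<lambda>n. lam ^ n / fact n"])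
     (use summable_exp[of lam] compatible_prob lam_pos in \<open>auto simp: field_simps mult_left_le\<close>)

lemma summable_weighted_size: "summable (\<lambda>n. real n * (lam ^ n / fact n) * compatible_prob n)"
proof (rule summable_comparison_test'[OF summable_poisson_mean])
  fix n :: nat
  have "real n * (lam ^ n / fact n) * compatible_prob n \<le> real n * (lam ^ n / fact n)"
    using compatible_prob lam_pos by (intro mult_left_le) auto
  moreover have "0 \<le> real n * (lam ^ n / fact n) * compatible_prob n"
    using compatible_prob lam_pos by (intro mult_nonneg_nonneg divide_nonneg_nonneg) auto
  ultimately show "norm (real n * (lam ^ n / fact n) * compatible_prob n) \<le> real n * (lam ^ n / fact n)"
    by (simp only: real_norm_def abs_of_nonneg)
qed

lemma weight_series: "weight = ennreal (exp (- lam) * (\<Sum>n. lam ^ n / fact n * compatible_prob n))"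
proof -
  have "weight = (\<Sum>n. ennreal (lam ^ n / fact n * exp (- lam)) * ennreal (compatible_prob n))"
    unfolding weight_def by (subst nn_integral_PP) (simp_all add: ennreal_compatible_prob)
  also have "\<dots> = (\<Sum>n. ennreal (exp (- lam) * (lam ^ n / fact n * compatible_prob n)))"
    using lam_pos compatible_prob by (intro suminf_cong) (simp add: ennreal_mult[symmetric] mult_ac)
  also have "\<dots> = ennreal (\<Sum>n. exp (- lam) * (lam ^ n / fact n * compatible_prob n))"
    using lam_pos compatible_prob
    by (intro suminf_ennreal2 summable_mult summable_weight) auto
  finally show ?thesis by (simp only: suminf_mult[OF summable_weight])
qed

lemma weighted_size_series:
  "weighted_size = ennreal (exp (- lam) * (\<Sum>n. real n * (lam ^ n / fact n) * compatible_prob n))"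
proof -
  have "weighted_size = (\<Sum>n. ennreal (lam ^ n / fact n * exp (- lam)) * (of_nat n * ennreal (compatible_prob n)))"
  proof -
    have "(\<integral>\<^sup>+x. of_bool (compatible (n, x)) * of_nat n \<partial>(\<Pi>\<^sub>M i\<in>UNIV. S)) =
        of_nat n * ennreal (compatible_prob n)" for n
      unfolding ennreal_compatible_prob by (subst nn_integral_multc) (simp_all add: mult.commute)
    then show ?thesis
      unfolding weighted_size_def by (subst nn_integral_PP) simp_all
  qed
  also have "\<dots> = (\<Sum>n. ennreal (exp (- lam) * (real n * (lam ^ n / fact n) * compatible_prob n)))"
    using lam_pos compatible_prob
    by (intro suminf_cong) (simp add: ennreal_mult[symmetric] ennreal_of_nat_eq_real_of_nat mult_ac)
  also have "\<dots> = ennreal (\<Sum>n. exp (- lam) * (real n * (lam ^ n / fact n) * compatible_prob n))"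
    using lam_pos compatible_prob
    by (intro suminf_ennreal2 summable_mult summable_weighted_size mult_nonneg_nonneg divide_nonneg_nonneg) auto
  finally show ?thesis by (simp only: suminf_mult[OF summable_weighted_size])
qed

lemma mean_size_series:
  "(\<Sum>n. real n * (lam ^ n / fact n) * compatible_prob n) =
    mean_size * (\<Sum>n. lam ^ n / fact n * compatible_prob n)"
  and weight_series_pos: "0 < (\<Sum>n. lam ^ n / fact n * compatible_prob n)"
proof -
  let ?A = "\<Sum>n. real n * (lam ^ n / fact n) * compatible_prob n"
  let ?B = "\<Sum>n. lam ^ n / fact n * compatible_prob n"
  show B: "0 < ?B"
    using weight_pos unfolding weight_series by (simp add: zero_less_mult_iff)
  have A: "0 \<le> ?A"
    using compatible_prob lam_pos
    by (intro suminf_nonneg summable_weighted_size mult_nonneg_nonneg divide_nonneg_nonneg) auto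
  have "ennreal (exp (- lam) * ?A) = ennreal (mean_size * (exp (- lam) * ?B))"
    using weighted_size_eq_mean B mean_size_nonneg
    unfolding weight_series weighted_size_series by (simp add: ennreal_mult)
  then have "exp (- lam) * ?A = mean_size * (exp (- lam) * ?B)"
    using A B mean_size_nonneg by (subst (asm) ennreal_inj) auto
  then show "?A = mean_size * ?B" by simp
qed

end

theorem mean_size_mono:
  assumes "hard_core S K s" "hard_core S K t" "s \<le> t"
  shows "hard_core.mean_size S K s \<le> hard_core.mean_size S K t"
proof -
  interpret s: hard_core S K s by fact
  interpret t: hard_core S K t by fact
  have "s.mean_size * (\<Sum>n. t ^ n / fact n * t.compatible_prob n) \<le>
      t.mean_size * (\<Sum>n. t ^ n / fact n * t.compatible_prob n)"
    unfolding t.mean_size_series[symmetric]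
    by (rule tilted_mean_mono[OF s.compatible_prob s.lam_pos assms(3) s.mean_size_series])
  then show ?thesis using t.weight_series_pos by (simp add: mult_le_cancel_right)
qed

section \<open>From sequences of points to configurations\<close>

text \<open>
  Counting first occurrences shows that the number of distinct points is a measurable function of
  the sequence.
\<close>

lemma card_image_lessThan:
  fixes f :: "nat \<Rightarrow> 'a"
  shows "card (f ` {..<n}) = card {i. i < n \<and> (\<forall>j<i. f j \<noteq> f i)}" (is "_ = card ?I")
proof -
  have "f ` {..<n} \<subseteq> f ` ?I"
  proof
    fix y assume "y \<in> f ` {..<n}"
    then obtain k where k: "k < n" "f k = y" by auto
    define i where "i = (LEAST i. f i = y)"
    have "f i = y" unfolding i_def using k(2) by (rule LeastI)
    moreover have "i \<le> k" unfolding i_def using k(2) by (rule Least_le)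
    moreover have "f j \<noteq> y" if "j < i" for j
      using not_less_Least[of j "\<lambda>i. f i = y"] that by (simp add: i_def)
    ultimately show "y \<in> f ` ?I" using k(1) by (auto intro!: image_eqI[of _ _ i])
  qed
  then have "f ` {..<n} = f ` ?I" by auto
  moreover have "inj_on f ?I"
    by (rule inj_onI) (metis (mono_tags, lifting) linorder_neqE_nat mem_Collect_eq)
  ultimately show ?thesis by (simp add: card_image)
qed

text \<open>
  The configuration is a set of points, while the preceding sections speak about sequences. The
  two descriptions agree almost surely when single points have measure zero.
\<close>

locale hard_core_points = hard_core +
  assumes eq_measurable: "Measurable.pred (S \<Otimes>\<^sub>M S) (\<lambda>p. fst p = snd p)"
    and no_atoms: "x \<in> space S \<Longrightarrow> (\<integral>\<^sup>+v. of_bool (x = v) \<partial>S) = 0"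
begin

lemma eq_measurable' [measurable (raw)]:
  assumes [measurable]: "f \<in> measurable M S" "g \<in> measurable M S"
  shows "Measurable.pred M (\<lambda>x. f x = g x)"
proof -
  have "(\<lambda>x. (f x, g x)) \<in> measurable M (S \<Otimes>\<^sub>M S)" by measurable
  from measurable_compose[OF this eq_measurable] show ?thesis by simp
qed

lemma config_card_measurable [measurable]: "(\<lambda>\<omega>. card (config \<omega>)) \<in> measurable PP (count_space UNIV)"
  unfolding config_def card_image_lessThan by measurable

definition conflict_free :: "(nat \<times> (nat \<Rightarrow> 'a)) set"
  where "conflict_free = {\<omega> \<in> space PP. \<forall>x\<in>config \<omega>. \<forall>y\<in>config \<omega>. x \<noteq> y \<longrightarrow> \<not> K x y}"

text \<open>
  By the Mecke formula the mean number of points that coincide with another one is \<open>lam\<close> times the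
  mean measure of a finite set, which vanishes.
\<close>

lemma AE_distinct: "AE \<omega> in PP. \<forall>i<fst \<omega>. \<forall>j<fst \<omega>. i \<noteq> j \<longrightarrow> snd \<omega> i \<noteq> snd \<omega> j"
proof -
  \<comment> \<open>The event that another entry equals the entry \<open>0\<close>.\<close>
  define F :: "nat \<times> (nat \<Rightarrow> 'a) \<Rightarrow> ennreal"
    where "F \<omega> = of_bool (\<exists>j<fst \<omega>. j \<noteq> 0 \<and> snd \<omega> 0 = snd \<omega> j)" for \<omega>
  have [measurable]: "F \<in> borel_measurable PP" unfolding F_def by measurable
  have "(\<integral>\<^sup>+u. F (add_point u \<omega>) \<partial>S) = 0" if \<omega> [measurable]: "\<omega> \<in> space PP" for \<omega>
  proof -
    have "(\<integral>\<^sup>+u. F (add_point u \<omega>) \<partial>S) \<le> (\<integral>\<^sup>+u. (\<Sum>j<fst \<omega>. of_bool (snd \<omega> j = u)) \<partial>S)"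
    proof (rule nn_integral_mono)
      fix u
      show "F (add_point u \<omega>) \<le> (\<Sum>j<fst \<omega>. of_bool (snd \<omega> j = u))"
      proof (cases "\<exists>j<fst \<omega>. snd \<omega> j = u")
        case True
        then obtain j where "j < fst \<omega>" "snd \<omega> j = u" by auto
        then have "1 \<le> (\<Sum>j<fst \<omega>. of_bool (snd \<omega> j = u) :: ennreal)"
          using member_le_sum[of j "{..<fst \<omega>}" "\<lambda>j. of_bool (snd \<omega> j = u) :: ennreal"] by simp
        then show ?thesis by (auto simp: F_def intro: order_trans[rotated])
      next
        case False
        then have "F (add_point u \<omega>) = 0"
          by (auto simp: F_def add_point_def less_Suc_eq_0_disj)
        then show ?thesis by simp
      qed
    qed
    also have "\<dots> = (\<Sum>j<fst \<omega>. \<integral>\<^sup>+u. of_bool (snd \<omega> j = u) \<partial>S)"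
    proof (rule nn_integral_sum)
      fix j
      have "snd \<omega> j \<in> space S" by (rule snd_PP_in_space) fact
      note [measurable] = measurable_const[OF this]
      show "(\<lambda>u. of_bool (snd \<omega> j = u)) \<in> borel_measurable S" by measurable
    qed
    also have "\<dots> = 0"
      by (intro sum.neutral ballI no_atoms snd_PP_in_space \<omega>)
    finally show ?thesis by simp
  qed
  then have "(\<integral>\<^sup>+\<omega>. \<integral>\<^sup>+u. F (add_point u \<omega>) \<partial>S \<partial>PP) = (\<integral>\<^sup>+\<omega>. 0 \<partial>PP)"
    by (intro nn_integral_cong) simp
  then have "(\<integral>\<^sup>+\<omega>. (\<Sum>i<fst \<omega>. F (swap_first i \<omega>)) \<partial>PP) = 0"
    by (subst mecke) simp_all
  then have "AE \<omega> in PP. (\<Sum>i<fst \<omega>. F (swap_first i \<omega>)) = 0"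
    by (subst (asm) nn_integral_0_iff_AE) simp_all
  then show ?thesis
  proof (rule AE_mp, intro AE_I2 impI allI)
    fix \<omega> i j
    assume 0: "(\<Sum>i<fst \<omega>. F (swap_first i \<omega>)) = 0" and ij: "i < fst \<omega>" "j < fst \<omega>" "i \<noteq> j"
    \<comment> \<open>After entry \<open>i\<close> has been moved to the front, entry \<open>j\<close> is found at position \<open>?t j\<close>.\<close>
    let ?t = "Transposition.transpose 0 i"
    have "F (swap_first i \<omega>) = 0" using 0 ij(1) by simp
    then have "\<forall>k<fst \<omega>. k \<noteq> 0 \<longrightarrow> snd \<omega> i \<noteq> snd \<omega> (?t k)"
      by (auto simp: F_def swap_first_def)
    moreover have "?t j < fst \<omega>" "?t j \<noteq> 0"
      using ij by (auto simp: Transposition.transpose_def)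
    ultimately show "snd \<omega> i \<noteq> snd \<omega> j"
      by (metis transpose_involutory)
  qed
qed

lemma conflict_free_iff:
  assumes "\<omega> \<in> space PP" "\<forall>i<fst \<omega>. \<forall>j<fst \<omega>. i \<noteq> j \<longrightarrow> snd \<omega> i \<noteq> snd \<omega> j"
  shows "\<omega> \<in> conflict_free \<longleftrightarrow> compatible \<omega>"
  using assms by (auto simp: conflict_free_def compatible_def config_def)

lemma conflict_free_sets [measurable]: "conflict_free \<in> sets PP"
proof -
  have "conflict_free = {\<omega> \<in> space PP. \<forall>i<fst \<omega>. \<forall>j<fst \<omega>. snd \<omega> i \<noteq> snd \<omega> j \<longrightarrow> \<not> K (snd \<omega> i) (snd \<omega> j)}"
    by (auto simp: conflict_free_def config_def)
  also have "\<dots> \<in> sets PP" by measurable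
  finally show ?thesis .
qed

theorem expected_config_size:
  "(LINT \<omega>|uniform_measure PP conflict_free. real (card (config \<omega>))) = mean_size"
proof -
  have ae: "AE \<omega> in PP. of_nat (card (config \<omega>)) * indicator conflict_free \<omega> =
      of_bool (compatible \<omega>) * (of_nat (fst \<omega>) :: ennreal)"
    using AE_distinct AE_space
  proof eventually_elim
    fix \<omega> assume *: "\<forall>i<fst \<omega>. \<forall>j<fst \<omega>. i \<noteq> j \<longrightarrow> snd \<omega> i \<noteq> snd \<omega> j" and \<omega>: "\<omega> \<in> space PP"
    have "inj_on (snd \<omega>) {..<fst \<omega>}" using * by (auto intro!: inj_onI)
    then have "card (config \<omega>) = fst \<omega>" by (simp add: config_def card_image)
    then show "of_nat (card (config \<omega>)) * indicator conflict_free \<omega> = of_bool (compatible \<omega>) * (of_nat (fst \<omega>) :: ennreal)"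
      using conflict_free_iff[OF \<omega> *] by (simp add: indicator_def)
  qed
  have ae': "AE \<omega> in PP. indicator conflict_free \<omega> = (of_bool (compatible \<omega>) :: ennreal)"
    using AE_distinct AE_space
    by eventually_elim (simp add: conflict_free_iff indicator_def)
  have "emeasure PP conflict_free = weight"
    unfolding weight_def using nn_integral_cong_AE[OF ae'] by simp
  moreover have "(\<integral>\<^sup>+\<omega>. of_nat (card (config \<omega>)) * indicator conflict_free \<omega> \<partial>PP) = weighted_size"
    unfolding weighted_size_def using ae by (rule nn_integral_cong_AE)
  ultimately have "(\<integral>\<^sup>+\<omega>. of_nat (card (config \<omega>)) \<partial>uniform_measure PP conflict_free) = weighted_size / weight"
    by (subst nn_integral_uniform_measure) simp_all
  then show ?thesis
    unfolding mean_size_def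
    by (subst integral_eq_nn_integral) (simp_all add: ennreal_of_nat_eq_real_of_nat)
qed

end

section \<open>Reflection invariance of Lebesgue measure\<close>

abbreviation vol :: "nat \<Rightarrow> (nat \<Rightarrow> real) measure"
  where "vol d \<equiv> \<Pi>\<^sub>M i\<in>{..<d}. lborel"

interpretation lborel_product: product_sigma_finite "\<lambda>_::nat. lborel :: real measure"
  by standard

lemma sigma_finite_vol: "sigma_finite_measure (vol d)"
  by (rule lborel_product.sigma_finite) simp

lemma dot_measurable [measurable (raw)]:
  assumes "\<And>i. i < d \<Longrightarrow> (\<lambda>z. f z i) \<in> borel_measurable M" "\<And>i. i < d \<Longrightarrow> (\<lambda>z. g z i) \<in> borel_measurable M"
  shows "(\<lambda>z. dot d (f z) (g z)) \<in> borel_measurable M"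
  unfolding dot_def using assms by (intro borel_measurable_sum borel_measurable_times) auto

lemma vol_component_measurable:
  assumes "f \<in> measurable M (vol d)" "i < d"
  shows "(\<lambda>z. f z i) \<in> borel_measurable M"
  using measurable_compose[OF assms(1) measurable_component_singleton[of i "{..<d}" "\<lambda>_. lborel"]] assms(2)
  by simp

lemma vol_add_diff_measurable [measurable (raw)]:
  assumes "f \<in> measurable M (vol d)" "g \<in> measurable M (vol d)"
  shows "(\<lambda>z. \<lambda>i\<in>{..<d}. f z i + g z i) \<in> measurable M (vol d)"
    and "(\<lambda>z. \<lambda>i\<in>{..<d}. f z i - g z i) \<in> measurable M (vol d)"
  using vol_component_measurable[OF assms(1)] vol_component_measurable[OF assms(2)]
  by (auto intro!: measurable_restrict borel_measurable_add borel_measurable_diff)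

lemma distr_vol_coordinatewise:
  fixes T :: "nat \<Rightarrow> real \<Rightarrow> real"
  assumes T [measurable]: "\<And>i. T i \<in> borel_measurable borel"
    and inv: "\<And>i. distr lborel borel (T i) = lborel"
  shows "distr (vol d) (vol d) (\<lambda>x. \<lambda>i\<in>{..<d}. T i (x i)) = vol d"
proof (rule lborel_product.PiM_eqI)
  fix A :: "nat \<Rightarrow> real set"
  assume A: "\<And>i. i \<in> {..<d} \<Longrightarrow> A i \<in> sets lborel"
  have meas: "(\<lambda>x. \<lambda>i\<in>{..<d}. T i (x i)) \<in> measurable (vol d) (vol d)"
    by measurable
  have TA: "T i -` A i \<in> sets lborel" if "i < d" for i
    using measurable_sets[OF T, of "A i" i] A[of i] that by simp
  have "(\<lambda>x. \<lambda>i\<in>{..<d}. T i (x i)) -` (\<Pi>\<^sub>E i\<in>{..<d}. A i) \<inter> space (vol d) =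
      (\<Pi>\<^sub>E i\<in>{..<d}. T i -` A i)"
    by (auto simp: space_PiM PiE_def Pi_def)
  then have "emeasure (distr (vol d) (vol d) (\<lambda>x. \<lambda>i\<in>{..<d}. T i (x i))) (\<Pi>\<^sub>E i\<in>{..<d}. A i) =
      emeasure (vol d) (\<Pi>\<^sub>E i\<in>{..<d}. T i -` A i)"
    using A by (subst emeasure_distr[OF meas]) (auto intro!: sets_PiM_I_finite)
  also have "\<dots> = (\<Prod>i<d. emeasure lborel (T i -` A i))"
    using TA by (subst lborel_product.emeasure_PiM) auto
  also have "\<dots> = (\<Prod>i<d. emeasure lborel (A i))"
  proof (rule prod.cong[OF refl])
    fix i assume "i \<in> {..<d}"
    then have "emeasure (distr lborel borel (T i)) (A i) = emeasure lborel (T i -` A i)"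
      using A by (subst emeasure_distr) auto
    then show "emeasure lborel (T i -` A i) = emeasure lborel (A i)" by (simp add: inv)
  qed
  finally show "emeasure (distr (vol d) (vol d) (\<lambda>x. \<lambda>i\<in>{..<d}. T i (x i))) (\<Pi>\<^sub>E i\<in>{..<d}. A i) =
      (\<Prod>i<d. emeasure lborel (A i))" .
qed auto

lemma distr_lborel_add: "distr lborel borel (\<lambda>x::real. x + c) = lborel"
  using lborel_distr_plus[of c] by (simp add: add.commute[of c] fun_eq_iff cong: distr_cong)

lemma distr_lborel_diff: "distr lborel borel (\<lambda>x::real. c - x) = lborel"
proof -
  have "distr lborel borel (\<lambda>x::real. c - x) = distr (distr lborel borel uminus) borel (\<lambda>x. c + x)"
    by (subst distr_distr) (simp_all add: o_def)
  also have "\<dots> = lborel"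
    using lborel_distr_plus[of c] by (simp add: lborel_distr_uminus)
  finally show ?thesis .
qed

lemma nn_integral_vol_add:
  assumes [measurable]: "f \<in> borel_measurable (vol d)"
  shows "(\<integral>\<^sup>+x. f (\<lambda>i\<in>{..<d}. x i + c i) \<partial>vol d) = (\<integral>\<^sup>+x. f x \<partial>vol d)"
proof -
  let ?t = "\<lambda>x. \<lambda>i\<in>{..<d}. x i + c i :: real"
  have "distr (vol d) (vol d) ?t = vol d"
    by (rule distr_vol_coordinatewise[where T = "\<lambda>i x. x + c i"]) (simp_all add: distr_lborel_add)
  then have "(\<integral>\<^sup>+x. f x \<partial>vol d) = (\<integral>\<^sup>+x. f x \<partial>distr (vol d) (vol d) ?t)" by simp
  also have "\<dots> = (\<integral>\<^sup>+x. f (?t x) \<partial>vol d)"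
    by (rule nn_integral_distr) measurable
  finally show ?thesis ..
qed

lemma nn_integral_vol_diff:
  assumes [measurable]: "f \<in> borel_measurable (vol d)"
  shows "(\<integral>\<^sup>+x. f (\<lambda>i\<in>{..<d}. c i - x i) \<partial>vol d) = (\<integral>\<^sup>+x. f x \<partial>vol d)"
proof -
  let ?t = "\<lambda>x. \<lambda>i\<in>{..<d}. c i - x i :: real"
  have "distr (vol d) (vol d) ?t = vol d"
    by (rule distr_vol_coordinatewise[where T = "\<lambda>i x. c i - x"]) (simp_all add: distr_lborel_diff)
  then have "(\<integral>\<^sup>+x. f x \<partial>vol d) = (\<integral>\<^sup>+x. f x \<partial>distr (vol d) (vol d) ?t)" by simp
  also have "\<dots> = (\<integral>\<^sup>+x. f (?t x) \<partial>vol d)"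
    by (rule nn_integral_distr) measurable
  finally show ?thesis ..
qed

lemma dot_commute: "dot d x y = dot d y x"
  by (simp add: dot_def mult.commute)

lemma dot_add_scaled: "dot d x (\<lambda>i\<in>{..<d}. y i + k * z i) = dot d x y + k * dot d x z"
  unfolding dot_def by (simp add: distrib_left sum.distrib sum_distrib_left mult_ac)

lemma dot_self_nonneg: "0 \<le> dot d x x"
  unfolding dot_def by (intro sum_nonneg) simp

lemma unit_ball_eq: "unit_ball d = {f. sqrt (\<Sum>i\<in>{..<d}. (f i)\<^sup>2) \<le> 1} \<inter> space (vol d)"
  by (auto simp: unit_ball_def dot_def power2_eq_square space_PiM)

lemma unit_ball_measurable [measurable]: "unit_ball d \<in> sets (vol d)"
proof -
  have "unit_ball d = {x \<in> space (vol d). dot d x x \<le> 1}" by (auto simp: unit_ball_def space_PiM)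
  also have "\<dots> \<in> sets (vol d)" by measurable
  finally show ?thesis .
qed

lemma emeasure_unit_ball: "emeasure (vol d) (unit_ball d) = ennreal (unit_ball_vol (real d))"
  using emeasure_cball_aux[of "{..<d}" 1] by (simp add: unit_ball_eq)

definition reflect :: "nat \<Rightarrow> (nat \<Rightarrow> real) \<Rightarrow> (nat \<Rightarrow> real) \<Rightarrow> (nat \<Rightarrow> real)"
  where "reflect d w x = (\<lambda>i\<in>{..<d}. x i + (- 2 * dot d w x / dot d w w) * w i)"

lemma dot_reflect: 
  assumes "dot d w w \<noteq> 0"
  shows "dot d (reflect d w x) y = dot d x (reflect d w y)"
    and "dot d (reflect d w x) (reflect d w y) = dot d x y"
proof -
  have 1: "dot d z (reflect d w y) = dot d z y - 2 * dot d w y / dot d w w * dot d z w" for z y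
    unfolding reflect_def dot_add_scaled by simp
  show 2: "dot d (reflect d w x) y = dot d x (reflect d w y)" for x y
    unfolding dot_commute[of d "reflect d w x" y] 1
    by (simp add: dot_commute[of d y x] dot_commute[of d y w] dot_commute[of d x w])
  have "dot d w (reflect d w y) = - dot d w y" using assms by (simp add: 1)
  then show "dot d (reflect d w x) (reflect d w y) = dot d x y"
    using assms unfolding 2 1[of x "reflect d w y"] by (simp add: 1[of x] dot_commute[of d x w])
qed

lemma reflect_reflect:
  assumes "dot d w w \<noteq> 0" "x \<in> space (vol d)"
  shows "reflect d w (reflect d w x) = x"
proof -
  have "dot d w (reflect d w x) = - dot d w x"
    unfolding reflect_def dot_add_scaled using assms by simp
  then show ?thesis
    using assms(2) by (auto simp: reflect_def fun_eq_iff space_PiM PiE_def extensional_def)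
qed

lemma reflect_add:
  "reflect d w (\<lambda>i\<in>{..<d}. x i + y i) = (\<lambda>i\<in>{..<d}. reflect d w x i + reflect d w y i)"
  using dot_add_scaled[of d w x 1 y]
  by (auto simp: reflect_def fun_eq_iff algebra_simps add_divide_distrib diff_divide_distrib)

lemma reflect_measurable [measurable (raw)]:
  assumes f: "f \<in> measurable M (vol d)"
  shows "(\<lambda>z. reflect d w (f z)) \<in> measurable M (vol d)"
  unfolding reflect_def
proof (rule measurable_restrict)
  fix i assume "i \<in> {..<d}"
  then have [measurable]: "(\<lambda>z. f z i) \<in> borel_measurable M"
    by (intro vol_component_measurable[OF f]) simp
  have [measurable]: "(\<lambda>z. dot d w (f z)) \<in> borel_measurable M"
    by (rule dot_measurable) (simp_all add: vol_component_measurable[OF f])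
  show "(\<lambda>z. f z i + (- 2 * dot d w (f z) / dot d w w) * w i) \<in> measurable M lborel"
    by simp
qed

text \<open>
  The argument for the uniqueness of a translation invariant measure: let \<open>\<mu>\<close> be Lebesgue measure and
  \<open>H\<close> the reflection, and write \<open>\<mu> (H\<^sup>-\<^sup>1 A) * \<mu> B\<close> as a double integral over \<open>x\<close> and \<open>y\<close>. The substitutions
  \<open>y \<mapsto> y + H x\<close>, then \<open>x \<mapsto> x - H y\<close>, then \<open>y \<mapsto> H x - y\<close> turn it into \<open>\<mu> A * \<mu> (H\<^sup>-\<^sup>1 B)\<close>. For the unit
  ball \<open>B\<close> the reflection changes nothing, and \<open>\<mu> B\<close> is positive and finite.
\<close>

lemma emeasure_reflect:
  assumes w: "dot d w w \<noteq> 0" and A [measurable]: "A \<in> sets (vol d)"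
  shows "emeasure (vol d) {x \<in> space (vol d). reflect d w x \<in> A} = emeasure (vol d) A"
proof -
  interpret V: sigma_finite_measure "vol d" by (rule sigma_finite_vol)
  interpret VV: pair_sigma_finite "vol d" "vol d" ..
  let ?B = "unit_ball d" and ?H = "reflect d w"
  let ?a = "indicator A :: _ \<Rightarrow> ennreal" and ?b = "indicator ?B :: _ \<Rightarrow> ennreal"
  have sp: "?H x \<in> space (vol d)" for x by (auto simp: reflect_def space_PiM)
  have "(\<integral>\<^sup>+x. ?a (?H x) \<partial>vol d) * emeasure (vol d) ?B =
      (\<integral>\<^sup>+x. ?a (?H x) * (\<integral>\<^sup>+y. ?b y \<partial>vol d) \<partial>vol d)"
    by (simp add: nn_integral_multc)
  also have "\<dots> = (\<integral>\<^sup>+x. ?a (?H x) * (\<integral>\<^sup>+y. ?b (\<lambda>i\<in>{..<d}. y i + ?H x i) \<partial>vol d) \<partial>vol d)"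
    by (subst nn_integral_vol_add) simp_all
  also have "\<dots> = (\<integral>\<^sup>+x. (\<integral>\<^sup>+y. ?a (?H x) * ?b (\<lambda>i\<in>{..<d}. y i + ?H x i) \<partial>vol d) \<partial>vol d)"
    by (intro nn_integral_cong nn_integral_cmult[symmetric]) measurable
  also have "\<dots> = (\<integral>\<^sup>+y. (\<integral>\<^sup>+x. ?a (?H x) * ?b (\<lambda>i\<in>{..<d}. y i + ?H x i) \<partial>vol d) \<partial>vol d)"
    by (rule VV.Fubini') (simp add: case_prod_beta')
  also have "\<dots> = (\<integral>\<^sup>+y. (\<integral>\<^sup>+x. ?a (\<lambda>i\<in>{..<d}. ?H x i - y i) * ?b (?H x) \<partial>vol d) \<partial>vol d)"
  proof (rule nn_integral_cong)
    fix y assume y: "y \<in> space (vol d)"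
    \<comment> \<open>The translation that becomes the translation by \<open>- y\<close> after the reflection.\<close>
    define c where "c = ?H (\<lambda>i\<in>{..<d}. - y i)"
    have my: "(\<lambda>i\<in>{..<d}. - y i) \<in> space (vol d)" by (auto simp: space_PiM)
    have Hc: "?H c i = - y i" if "i < d" for i
      using reflect_reflect[OF w my] that by (simp add: c_def)
    have e1: "?H (\<lambda>i\<in>{..<d}. x i + c i) = (\<lambda>i\<in>{..<d}. ?H x i - y i)" for x
      unfolding reflect_add using Hc by (auto simp: fun_eq_iff)
    have e2: "(\<lambda>i\<in>{..<d}. y i + (\<lambda>i\<in>{..<d}. ?H x i - y i) i) = ?H x" for x
      using sp[of x] by (auto simp: fun_eq_iff reflect_def)
    have "(\<integral>\<^sup>+x. ?a (?H x) * ?b (\<lambda>i\<in>{..<d}. y i + ?H x i) \<partial>vol d) =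
        (\<integral>\<^sup>+x. ?a (?H (\<lambda>i\<in>{..<d}. x i + c i)) * ?b (\<lambda>i\<in>{..<d}. y i + ?H (\<lambda>i\<in>{..<d}. x i + c i) i) \<partial>vol d)"
    proof (rule nn_integral_vol_add[symmetric, where f = "\<lambda>x. ?a (?H x) * ?b (\<lambda>i\<in>{..<d}. y i + ?H x i)"])
      note [measurable] = y
      show "(\<lambda>x. ?a (?H x) * ?b (\<lambda>i\<in>{..<d}. y i + ?H x i)) \<in> borel_measurable (vol d)" by measurable
    qed
    then show "(\<integral>\<^sup>+x. ?a (?H x) * ?b (\<lambda>i\<in>{..<d}. y i + ?H x i) \<partial>vol d) =
        (\<integral>\<^sup>+x. ?a (\<lambda>i\<in>{..<d}. ?H x i - y i) * ?b (?H x) \<partial>vol d)"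
      by (simp only: e1 e2)
  qed
  also have "\<dots> = (\<integral>\<^sup>+x. (\<integral>\<^sup>+y. ?a (\<lambda>i\<in>{..<d}. ?H x i - y i) * ?b (?H x) \<partial>vol d) \<partial>vol d)"
    by (rule VV.Fubini'[symmetric]) (simp add: case_prod_beta')
  also have "\<dots> = (\<integral>\<^sup>+x. (\<integral>\<^sup>+y. ?a (\<lambda>i\<in>{..<d}. ?H x i - y i) \<partial>vol d) * ?b (?H x) \<partial>vol d)"
    by (intro nn_integral_cong nn_integral_multc) measurable
  also have "\<dots> = (\<integral>\<^sup>+x. emeasure (vol d) A * ?b (?H x) \<partial>vol d)"
    by (subst nn_integral_vol_diff) simp_all
  also have "\<dots> = (\<integral>\<^sup>+x. emeasure (vol d) A * ?b x \<partial>vol d)"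
  proof (rule nn_integral_cong)
    fix x assume "x \<in> space (vol d)"
    then have "?H x \<in> ?B \<longleftrightarrow> x \<in> ?B"
      using sp[of x] dot_reflect(2)[OF w, of x x] by (auto simp: unit_ball_def space_PiM)
    then show "emeasure (vol d) A * ?b (?H x) = emeasure (vol d) A * ?b x"
      by (simp add: indicator_def)
  qed
  also have "\<dots> = emeasure (vol d) A * emeasure (vol d) ?B"
    by (simp add: nn_integral_cmult)
  finally have "emeasure (vol d) ?B * (\<integral>\<^sup>+x. ?a (?H x) \<partial>vol d) = emeasure (vol d) ?B * emeasure (vol d) A"
    by (simp add: mult.commute)
  moreover have "emeasure (vol d) ?B \<noteq> 0" "emeasure (vol d) ?B \<noteq> top"
    using less_imp_neq[OF unit_ball_vol_pos[of "real d"]] by (simp_all add: emeasure_unit_ball)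
  ultimately have "(\<integral>\<^sup>+x. ?a (?H x) \<partial>vol d) = emeasure (vol d) A"
    by (metis ennreal_mult_cancel_left)
  moreover have "(\<integral>\<^sup>+x. ?a (?H x) \<partial>vol d) = emeasure (vol d) {x \<in> space (vol d). ?H x \<in> A}"
  proof -
    have "(\<integral>\<^sup>+x. ?a (?H x) \<partial>vol d) = (\<integral>\<^sup>+x. indicator {x \<in> space (vol d). ?H x \<in> A} x \<partial>vol d)"
      by (intro nn_integral_cong) (auto simp: indicator_def)
    also have "\<dots> = emeasure (vol d) {x \<in> space (vol d). ?H x \<in> A}"
      by (rule nn_integral_indicator) measurable
    finally show ?thesis .
  qed
  ultimately show ?thesis by simp
qed

section \<open>Surface measure on the sphere\<close>

lemma sets_vol: "sets (vol d) = sets (\<Pi>\<^sub>M i\<in>{..<d}. borel)"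
  by (intro sets_PiM_cong refl) simp_all

lemma dot_vol_measurable: "dot d a \<in> borel_measurable (vol d)" "(\<lambda>x. dot d x x) \<in> borel_measurable (vol d)"
  by (rule dot_measurable; rule vol_component_measurable measurable_const; simp)+

lemma radial_projection_measurable [measurable]:
  "radial_projection d \<in> measurable (vol d) (\<Pi>\<^sub>M i\<in>{..<d}. borel)"
  unfolding radial_projection_def
proof (rule measurable_restrict)
  fix i assume "i \<in> {..<d}"
  then have [measurable]: "(\<lambda>x. x i) \<in> borel_measurable (vol d)"
    by (intro vol_component_measurable) simp_all
  note [measurable] = dot_vol_measurable(2)
  show "(\<lambda>x. x i / sqrt (dot d x x)) \<in> borel_measurable (vol d)" by measurable
qed

lemma unit_sphere_measurable [measurable]: "unit_sphere d \<in> sets (\<Pi>\<^sub>M i\<in>{..<d}. borel)"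
proof -
  note [measurable] = dot_vol_measurable(2)
  have "unit_sphere d = {x \<in> space (vol d). dot d x x = 1}"
    by (auto simp: unit_sphere_def space_PiM)
  also have "\<dots> \<in> sets (vol d)" by measurable
  finally show ?thesis by (simp add: sets_vol)
qed

lemma space_sphere_measure: "space (sphere_measure d) = unit_sphere d"
  unfolding sphere_measure_def
  by (auto simp: space_restrict_space space_PiM unit_sphere_def)

lemma sets_sphere_measure:
  "sets (sphere_measure d) = sets (restrict_space (\<Pi>\<^sub>M i\<in>{..<d}. borel) (unit_sphere d))"
  unfolding sphere_measure_def by (intro sets_restrict_space_cong) simp

lemma dot_radial_projection_right: "dot d a (radial_projection d x) = dot d a x / sqrt (dot d x x)"
  unfolding dot_def radial_projection_def by (simp add: sum_divide_distrib)

lemma dot_radial_projection: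
  assumes "dot d x x > 0"
  shows "dot d (radial_projection d x) (radial_projection d x) = 1"
proof -
  have "dot d (radial_projection d x) x = dot d x x / sqrt (dot d x x)"
    by (subst dot_commute) (rule dot_radial_projection_right)
  then show ?thesis
    using assms unfolding dot_radial_projection_right[of d "radial_projection d x"] by (simp add: real_div_sqrt)
qed

lemma radial_projection_in_sphere: "dot d x x > 0 \<Longrightarrow> radial_projection d x \<in> unit_sphere d"
  using dot_radial_projection[of d x] by (auto simp: unit_sphere_def radial_projection_def)

lemma dot_self_eq_0_imp: "dot d x x = 0 \<Longrightarrow> i < d \<Longrightarrow> x i = 0"
  unfolding dot_def by (subst (asm) sum_nonneg_eq_0_iff) auto

lemma radial_projection_0_notin_sphere: "dot d x x = 0 \<Longrightarrow> radial_projection d x \<notin> unit_sphere d"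
  by (auto simp: unit_sphere_def dot_radial_projection_right)

lemma emeasure_sphere_measure:
  assumes A: "A \<in> sets (sphere_measure d)"
  shows "emeasure (sphere_measure d) A =
    emeasure (vol d) {x \<in> unit_ball d. radial_projection d x \<in> A} / emeasure (vol d) (unit_ball d)"
proof -
  have A': "A \<in> sets (\<Pi>\<^sub>M i\<in>{..<d}. borel)" "A \<subseteq> unit_sphere d"
    using A unit_sphere_measurable[of d]
    by (auto simp: sets_sphere_measure sets_restrict_space_iff space_PiM unit_sphere_def)
  have "emeasure (sphere_measure d) A =
      emeasure (distr (uniform_measure (vol d) (unit_ball d)) (\<Pi>\<^sub>M i\<in>{..<d}. borel) (radial_projection d)) A"
    unfolding sphere_measure_def using A' unit_sphere_measurable[of d]
    by (intro emeasure_restrict_space) (auto simp: space_PiM unit_sphere_def)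
  also have "\<dots> = emeasure (uniform_measure (vol d) (unit_ball d)) (radial_projection d -` A \<inter> space (vol d))"
    using A' by (subst emeasure_distr) simp_all
  also have "\<dots> = emeasure (vol d) (unit_ball d \<inter> (radial_projection d -` A \<inter> space (vol d))) / emeasure (vol d) (unit_ball d)"
    using measurable_sets[OF radial_projection_measurable A'(1)]
    by (intro emeasure_uniform_measure) simp_all
  also have "unit_ball d \<inter> (radial_projection d -` A \<inter> space (vol d)) = {x \<in> unit_ball d. radial_projection d x \<in> A}"
    by (auto simp: unit_ball_def space_PiM)
  finally show ?thesis .
qed

lemma emeasure_vol_origin:
  assumes "d \<ge> 1" shows "emeasure (vol d) {x \<in> space (vol d). dot d x x = 0} = 0"
proof -
  have "{x \<in> space (vol d). dot d x x = 0} \<subseteq> (\<Pi>\<^sub>E i\<in>{..<d}. {0})"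
    by (intro subsetI PiE_I) (auto simp: space_PiM PiE_def extensional_def dot_self_eq_0_imp)
  moreover have "(\<Pi>\<^sub>E i\<in>{..<d}. {0 :: real}) \<in> sets (vol d)"
    by (rule sets_PiM_I_finite) auto
  ultimately have "emeasure (vol d) {x \<in> space (vol d). dot d x x = 0} \<le> emeasure (vol d) (\<Pi>\<^sub>E i\<in>{..<d}. {0})"
    by (rule emeasure_mono)
  also have "\<dots> = (\<Prod>i<d. emeasure lborel {0 :: real})"
    by (rule lborel_product.emeasure_PiM) auto
  also have "\<dots> = 0"
    using assms by (simp add: power_0_left)
  finally show ?thesis by simp
qed

lemma emeasure_vol_nonzero:
  assumes "d \<ge> 1" "A \<in> sets (vol d)"
  shows "emeasure (vol d) {x \<in> A. dot d x x > 0} = emeasure (vol d) A"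
proof -
  note [measurable] = dot_vol_measurable(2)
  have "{x \<in> A. dot d x x > 0} = {x \<in> space (vol d). x \<in> A \<and> dot d x x > 0}"
    using sets.sets_into_space[OF assms(2)] by auto
  moreover have "\<dots> \<in> sets (vol d)" using assms(2) by measurable
  moreover have "AE x in vol d. x \<in> A \<longleftrightarrow> x \<in> {x \<in> A. dot d x x > 0}"
  proof (rule AE_I')
    show "{x \<in> space (vol d). dot d x x = 0} \<in> null_sets (vol d)"
      using emeasure_vol_origin[OF assms(1)] by (auto intro!: null_setsI)
    show "{x \<in> space (vol d). \<not> (x \<in> A \<longleftrightarrow> x \<in> {x \<in> A. dot d x x > 0})} \<subseteq> {x \<in> space (vol d). dot d x x = 0}"
      using dot_self_nonneg[of d] by (auto simp: order_less_le)
  qed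
  ultimately show ?thesis using assms(2)
    by (intro emeasure_eq_AE) auto
qed

lemma prob_space_sphere_measure:
  assumes "d \<ge> 1" shows "prob_space (sphere_measure d)"
proof
  have "{x \<in> unit_ball d. radial_projection d x \<in> unit_sphere d} = {x \<in> unit_ball d. dot d x x > 0}"
    using radial_projection_in_sphere[of d] radial_projection_0_notin_sphere[of d] dot_self_nonneg[of d]
    by (force simp: order_less_le)
  then have "emeasure (vol d) {x \<in> unit_ball d. radial_projection d x \<in> unit_sphere d} = emeasure (vol d) (unit_ball d)"
    using emeasure_vol_nonzero[OF assms unit_ball_measurable] by simp
  then have "emeasure (sphere_measure d) (unit_sphere d) = emeasure (vol d) (unit_ball d) / emeasure (vol d) (unit_ball d)"
    by (subst emeasure_sphere_measure) (use sets.top[of "sphere_measure d"] in \<open>simp_all add: space_sphere_measure\<close>)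
  also have "\<dots> = 1"
    using less_imp_neq[OF unit_ball_vol_pos[of "real d"]] by (simp add: emeasure_unit_ball)
  finally show "emeasure (sphere_measure d) (space (sphere_measure d)) = 1"
    by (simp add: space_sphere_measure)
qed

section \<open>Rotation invariance of spherical caps\<close>

text \<open>
  The solid cone over a spherical cap with cosine \<open>c\<close>, including the origin.
\<close>

definition cone :: "nat \<Rightarrow> (nat \<Rightarrow> real) \<Rightarrow> real \<Rightarrow> (nat \<Rightarrow> real) set"
  where "cone d x c = {y \<in> unit_ball d. dot d x y \<ge> c * sqrt (dot d y y)}"

lemma cone_measurable [measurable]: "cone d x c \<in> sets (vol d)"
proof -
  have "(\<lambda>y. c * sqrt (dot d y y)) \<in> borel_measurable (vol d)"
    using dot_vol_measurable(2) by (intro borel_measurable_times borel_measurable_sqrt) simp_all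
  then have "{y \<in> space (vol d). c * sqrt (dot d y y) \<le> dot d x y} \<in> sets (vol d)"
    using dot_vol_measurable(1) by (rule borel_measurable_le)
  moreover have "cone d x c = unit_ball d \<inter> {y \<in> space (vol d). c * sqrt (dot d y y) \<le> dot d x y}"
    by (auto simp: cone_def unit_ball_def space_PiM)
  ultimately show ?thesis using unit_ball_measurable[of d] by simp
qed

lemma sphere_coordinate_measurable:
  "i < d \<Longrightarrow> (\<lambda>x. x i) \<in> borel_measurable (sphere_measure d)"
  by (subst measurable_cong_sets[OF sets_sphere_measure refl])
     (intro measurable_restrict_space1 measurable_component_singleton, simp)

lemma dot_sphere_measurable [measurable (raw)]:
  assumes "f \<in> measurable M (sphere_measure d)" "g \<in> measurable M (sphere_measure d)"
  shows "(\<lambda>z. dot d (f z) (g z)) \<in> borel_measurable M"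
  by (intro dot_measurable measurable_compose[OF assms(1) sphere_coordinate_measurable]
      measurable_compose[OF assms(2) sphere_coordinate_measurable])

lemma dot_sphere_measurable' [measurable]: "dot d x \<in> borel_measurable (sphere_measure d)"
  by (rule dot_measurable) (auto intro: sphere_coordinate_measurable)

lemma spherical_cap_measurable [measurable]: "spherical_cap d x \<phi> \<in> sets (sphere_measure d)"
proof -
  have "spherical_cap d x \<phi> = {y \<in> space (sphere_measure d). dot d x y \<ge> cos \<phi>}"
    by (auto simp: spherical_cap_def space_sphere_measure)
  also have "\<dots> \<in> sets (sphere_measure d)" by measurable
  finally show ?thesis .
qed

lemma emeasure_spherical_cap:
  assumes "d \<ge> 1"
  shows "emeasure (sphere_measure d) (spherical_cap d x \<phi>) =
    emeasure (vol d) (cone d x (cos \<phi>)) / emeasure (vol d) (unit_ball d)"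
proof -
  have "{y \<in> unit_ball d. radial_projection d y \<in> spherical_cap d x \<phi>} = {y \<in> cone d x (cos \<phi>). dot d y y > 0}"
  proof (rule set_eqI)
    fix y
    show "y \<in> {y \<in> unit_ball d. radial_projection d y \<in> spherical_cap d x \<phi>} \<longleftrightarrow>
        y \<in> {y \<in> cone d x (cos \<phi>). dot d y y > 0}"
    proof (cases "dot d y y > 0")
      case True
      then show ?thesis
        by (simp add: spherical_cap_def cone_def dot_radial_projection_right radial_projection_in_sphere pos_le_divide_eq)
    next
      case False
      then have "dot d y y = 0" using dot_self_nonneg[of d y] by simp
      then show ?thesis using radial_projection_0_notin_sphere[of d y] by (simp add: spherical_cap_def)
    qed
  qed
  then show ?thesis
    using emeasure_vol_nonzero[OF assms cone_measurable[of d x "cos \<phi>"]]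
    by (subst emeasure_sphere_measure) simp_all
qed

lemma dot_pole:
  assumes "d \<ge> 1" shows "dot d (pole d) y = y 0"
proof -
  have "dot d (pole d) y = (\<Sum>i<d. if i = 0 then y i else 0)"
    unfolding dot_def by (intro sum.cong) (auto simp: pole_def)
  then show ?thesis using assms by (simp add: sum.delta')
qed

lemma pole_in_sphere: "d \<ge> 1 \<Longrightarrow> pole d \<in> unit_sphere d"
  unfolding unit_sphere_def by (simp add: dot_pole) (simp add: pole_def)

lemma unit_vectors_eq:
  assumes "x \<in> unit_sphere d" "y \<in> unit_sphere d" "dot d x y = 1"
  shows "x = y"
proof -
  have "dot d (\<lambda>i. x i - y i) (\<lambda>i. x i - y i) = dot d x x - 2 * dot d x y + dot d y y"
    unfolding dot_def by (simp add: algebra_simps sum.distrib sum_subtractf sum_distrib_left)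
  then have "dot d (\<lambda>i. x i - y i) (\<lambda>i. x i - y i) = 0"
    using assms by (simp add: unit_sphere_def)
  then have "x i = y i" if "i < d" for i
    using dot_self_eq_0_imp[of d "\<lambda>i. x i - y i" i] that by simp
  then show ?thesis
    using assms(1,2) by (intro PiE_ext[of x "{..<d}" "\<lambda>_. UNIV" y]) (auto simp: unit_sphere_def)
qed

text \<open>
  The reflection in the hyperplane orthogonal to \<open>x - y\<close> exchanges the unit vectors \<open>x\<close> and \<open>y\<close>.
\<close>

lemma reflection_exists:
  assumes x: "x \<in> unit_sphere d" and y: "y \<in> unit_sphere d" and "x \<noteq> y"
  defines "w \<equiv> \<lambda>i\<in>{..<d}. x i + (- 1) * y i"
  shows "dot d w w \<noteq> 0" "reflect d w x = y"
proof -
  have xx: "dot d x x = 1" "dot d y y = 1" using x y by (auto simp: unit_sphere_def)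
  have w: "dot d z w = dot d z x - dot d z y" for z
    unfolding w_def dot_add_scaled by simp
  have yx: "dot d y x = dot d x y" by (rule dot_commute)
  have wx: "dot d w x = 1 - dot d x y"
    unfolding dot_commute[of d w x] w by (simp add: xx)
  have "dot d w y = dot d x y - 1"
    unfolding dot_commute[of d w y] w by (simp add: xx yx)
  then have ww: "dot d w w = 2 * (1 - dot d x y)"
    unfolding w[of w] by (simp add: wx)
  have ne: "dot d x y \<noteq> 1" using unit_vectors_eq[OF x y] \<open>x \<noteq> y\<close> by auto
  then show "dot d w w \<noteq> 0" by (simp add: ww)
  have "-2 * dot d w x / dot d w w = -1" using ne by (simp add: wx ww field_simps)
  then show "reflect d w x = y"
    using y unfolding reflect_def by (auto simp: w_def fun_eq_iff unit_sphere_def PiE_def extensional_def)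
qed

lemma emeasure_cone_rotation:
  assumes x: "x \<in> unit_sphere d" and y: "y \<in> unit_sphere d"
  shows "emeasure (vol d) (cone d x c) = emeasure (vol d) (cone d y c)"
proof (cases "x = y")
  case False
  define w where "w = (\<lambda>i\<in>{..<d}. x i + (- 1) * y i)"
  note w = reflection_exists[OF x y False, folded w_def]
  have "{z \<in> space (vol d). reflect d w z \<in> cone d x c} = cone d y c"
  proof (rule set_eqI)
    fix z
    have "dot d x (reflect d w z) = dot d y z"
      using dot_reflect(1)[OF w(1), of x z] w(2) by simp
    moreover have "reflect d w z \<in> {..<d} \<rightarrow>\<^sub>E UNIV" by (auto simp: reflect_def)
    ultimately show "z \<in> {z \<in> space (vol d). reflect d w z \<in> cone d x c} \<longleftrightarrow> z \<in> cone d y c"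
      using dot_reflect(2)[OF w(1), of z z]
      by (auto simp: cone_def unit_ball_def space_PiM)
  qed
  then show ?thesis using emeasure_reflect[OF w(1) cone_measurable[of d x c]] by simp
qed simp

lemma emeasure_cap_eq_cap_area:
  assumes d: "d \<ge> 1" and x: "x \<in> unit_sphere d"
  shows "emeasure (sphere_measure d) (spherical_cap d x \<phi>) = ennreal (cap_area d \<phi>)"
proof -
  interpret prob_space "sphere_measure d" by (rule prob_space_sphere_measure[OF d])
  have "emeasure (sphere_measure d) (spherical_cap d x \<phi>) = emeasure (sphere_measure d) (spherical_cap d (pole d) \<phi>)"
    unfolding emeasure_spherical_cap[OF d] emeasure_cone_rotation[OF x pole_in_sphere[OF d]] ..
  then show ?thesis by (simp add: cap_area_def emeasure_eq_measure)
qed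

section \<open>Bounds for the area of a spherical cap\<close>

text \<open>
  Cylinders around the axis through the pole have an explicit volume and approximate the cone over
  a cap from both sides well enough to find the exponential rate of its area.
\<close>

definition cylinder :: "nat \<Rightarrow> real \<Rightarrow> real \<Rightarrow> real \<Rightarrow> (nat \<Rightarrow> real) set"
  where "cylinder d l u r = {y \<in> space (vol d). y 0 \<in> {l..u} \<and> sqrt (\<Sum>i\<in>{1..<d}. (y i)\<^sup>2) \<le> r}"

lemma cylinder_measurable: "d \<ge> 1 \<Longrightarrow> cylinder d l u r \<in> sets (vol d)"
proof -
  assume d: "d \<ge> 1"
  have c: "(\<lambda>y. y i) \<in> borel_measurable (vol d)" if "i < d" for i
    using that by (intro vol_component_measurable) simp_all
  then have [measurable]: "(\<lambda>y. \<Sum>i\<in>{1..<d}. (y i)\<^sup>2) \<in> borel_measurable (vol d)"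
    by (intro borel_measurable_sum borel_measurable_power) simp
  have [measurable]: "(\<lambda>y. y 0) \<in> borel_measurable (vol d)" using c d by simp
  show ?thesis unfolding cylinder_def by measurable
qed

lemma emeasure_cylinder:
  assumes d: "d \<ge> 1" and lu: "l \<le> u" and r: "r > 0"
  shows "emeasure (vol d) (cylinder d l u r) = ennreal ((u - l) * (unit_ball_vol (real (d - 1)) * r ^ (d - 1)))"
proof -
  let ?I = "{1..<d}" and ?L = "\<lambda>_. lborel :: real measure"
  let ?B = "{f. sqrt (\<Sum>i\<in>?I. (f i)\<^sup>2) \<le> r} \<inter> space (Pi\<^sub>M ?I ?L)"
  have I: "{..<d} = insert 0 ?I" using d by auto
  have B: "?B \<in> sets (Pi\<^sub>M ?I ?L)"
  proof -
    have [measurable]: "(\<lambda>y. \<Sum>i\<in>?I. (y i)\<^sup>2) \<in> borel_measurable (Pi\<^sub>M ?I ?L)"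
      by measurable
    have "?B = {f \<in> space (Pi\<^sub>M ?I ?L). sqrt (\<Sum>i\<in>?I. (f i)\<^sup>2) \<le> r}" by auto
    also have "\<dots> \<in> sets (Pi\<^sub>M ?I ?L)" by measurable
    finally show ?thesis .
  qed
  have "emeasure (vol d) (cylinder d l u r) = (\<integral>\<^sup>+x. indicator (cylinder d l u r) x \<partial>vol d)"
    using cylinder_measurable[OF d] by simp
  also have "\<dots> = (\<integral>\<^sup>+y. \<integral>\<^sup>+x. indicator (cylinder d l u r) (x(0 := y)) \<partial>Pi\<^sub>M ?I ?L \<partial>lborel)"
  proof -
    have "(indicator (cylinder d l u r) :: _ \<Rightarrow> ennreal) \<in> borel_measurable (Pi\<^sub>M (insert 0 ?I) ?L)"
      using borel_measurable_indicator[OF cylinder_measurable[OF d, of l u r]] unfolding I .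
    then show ?thesis
      unfolding I by (intro lborel_product.product_nn_integral_insert_rev) simp_all
  qed
  also have "\<dots> = (\<integral>\<^sup>+y. \<integral>\<^sup>+x. indicator {l..u} y * indicator ?B x \<partial>Pi\<^sub>M ?I ?L \<partial>lborel)"
  proof (intro nn_integral_cong)
    fix x :: "nat \<Rightarrow> real" and y :: real assume "x \<in> space (Pi\<^sub>M ?I ?L)"
    then have "x(0 := y) \<in> space (vol d)"
      unfolding I by (auto simp: space_PiM PiE_def extensional_def)
    moreover have "(\<Sum>i\<in>?I. ((x(0 := y)) i)\<^sup>2) = (\<Sum>i\<in>?I. (x i)\<^sup>2)" by (intro sum.cong) auto
    ultimately show "indicator (cylinder d l u r) (x(0 := y)) = (indicator {l..u} y * indicator ?B x :: ennreal)"
      using \<open>x \<in> space (Pi\<^sub>M ?I ?L)\<close> by (simp add: cylinder_def indicator_def)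
  qed
  also have "\<dots> = (\<integral>\<^sup>+y. indicator {l..u} y * emeasure (Pi\<^sub>M ?I ?L) ?B \<partial>lborel)"
  proof (intro nn_integral_cong)
    fix y :: real
    have "(\<integral>\<^sup>+x. indicator {l..u} y * indicator ?B x \<partial>Pi\<^sub>M ?I ?L) = indicator {l..u} y * (\<integral>\<^sup>+x. indicator ?B x \<partial>Pi\<^sub>M ?I ?L)"
      by (rule nn_integral_cmult) (rule borel_measurable_indicator[OF B])
    then show "(\<integral>\<^sup>+x. indicator {l..u} y * indicator ?B x \<partial>Pi\<^sub>M ?I ?L) = indicator {l..u} y * emeasure (Pi\<^sub>M ?I ?L) ?B"
      by (simp only: nn_integral_indicator[OF B])
  qed
  also have "\<dots> = ennreal (u - l) * emeasure (Pi\<^sub>M ?I ?L) ?B"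
    using lu by (subst nn_integral_multc) simp_all
  also have "emeasure (Pi\<^sub>M ?I ?L) ?B = ennreal (unit_ball_vol (real (d - 1)) * r ^ (d - 1))"
    using emeasure_cball_aux[of ?I r] r by simp
  also have "ennreal (u - l) * \<dots> = ennreal ((u - l) * (unit_ball_vol (real (d - 1)) * r ^ (d - 1)))"
    using lu r by (intro ennreal_mult[symmetric]) (auto intro!: mult_nonneg_nonneg less_imp_le[OF unit_ball_vol_pos])
  finally show ?thesis .
qed

lemma dot_self_split:
  assumes "d \<ge> 1" shows "dot d y y = (y 0)\<^sup>2 + (\<Sum>i\<in>{1..<d}. (y i)\<^sup>2)"
proof -
  have "{..<d} = insert 0 {1..<d}" using assms by auto
  then show ?thesis unfolding dot_def by (simp add: power2_eq_square)
qed

text \<open>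
  A point of the cone of length at most \<open>1\<close> has distance at most \<open>sin \<phi>\<close> from the axis.
\<close>

lemma cone_subset_cylinder:
  assumes d: "d \<ge> 1" and \<phi>: "0 < \<phi>" "\<phi> < pi / 2"
  shows "cone d (pole d) (cos \<phi>) \<subseteq> cylinder d 0 1 (sin \<phi>)"
proof
  fix y assume y: "y \<in> cone d (pole d) (cos \<phi>)"
  define \<rho> where "\<rho> = (\<Sum>i\<in>{1..<d}. (y i)\<^sup>2)"
  have c: "0 < cos \<phi>" and s: "0 < sin \<phi>" using \<phi> by (auto simp: cos_gt_zero sin_gt_zero)
  have \<rho>: "0 \<le> \<rho>" unfolding \<rho>_def by (intro sum_nonneg) simp
  have N: "dot d y y = (y 0)\<^sup>2 + \<rho>" unfolding \<rho>_def by (rule dot_self_split[OF d])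
  have le1: "(y 0)\<^sup>2 + \<rho> \<le> 1" and ge: "cos \<phi> * sqrt ((y 0)\<^sup>2 + \<rho>) \<le> y 0"
    using y d by (auto simp: cone_def unit_ball_def dot_pole N)
  have y0: "0 \<le> y 0" using ge c \<rho> by (meson mult_nonneg_nonneg less_imp_le order_trans real_sqrt_ge_zero add_nonneg_nonneg zero_le_power2)
  have "(y 0)\<^sup>2 \<le> 1\<^sup>2" using le1 \<rho> by simp
  then have y1: "y 0 \<le> 1" by (rule power2_le_imp_le) simp
  have "(cos \<phi> * sqrt ((y 0)\<^sup>2 + \<rho>))\<^sup>2 \<le> (y 0)\<^sup>2"
    using ge c \<rho> by (intro power_mono) auto
  then have "(cos \<phi>)\<^sup>2 * ((y 0)\<^sup>2 + \<rho>) \<le> (y 0)\<^sup>2"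
    using \<rho> by (simp add: power_mult_distrib)
  then have "\<rho> \<le> (1 - (cos \<phi>)\<^sup>2) * ((y 0)\<^sup>2 + \<rho>)" by (simp add: algebra_simps)
  also have "\<dots> \<le> (1 - (cos \<phi>)\<^sup>2) * 1"
    using le1 by (intro mult_left_mono) (auto simp: sin_squared_eq[symmetric])
  also have "\<dots> = (sin \<phi>)\<^sup>2" by (simp add: sin_squared_eq)
  finally have "sqrt \<rho> \<le> sin \<phi>" using s by (intro real_le_lsqrt) auto
  then show "y \<in> cylinder d 0 1 (sin \<phi>)"
    using y y0 y1 by (auto simp: cylinder_def \<rho>_def cone_def unit_ball_def space_PiM)
qed

text \<open>
  The cone narrows towards the origin; at height \<open>cos \<phi> * t\<close> it still has radius \<open>sin \<phi> * t\<close>. At the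
  top, \<open>cos \<phi>\<close>, the cylinder is contained in the ball because \<open>cos\<^sup>2 \<phi> + sin\<^sup>2 \<phi> = 1\<close>.
\<close>

lemma cylinder_subset_cone:
  assumes d: "d \<ge> 1" and \<phi>: "0 < \<phi>" "\<phi> < pi / 2" and t: "0 \<le> t" "t \<le> 1"
  shows "cylinder d (cos \<phi> * t) (cos \<phi>) (sin \<phi> * t) \<subseteq> cone d (pole d) (cos \<phi>)"
proof
  fix y assume y: "y \<in> cylinder d (cos \<phi> * t) (cos \<phi>) (sin \<phi> * t)"
  define \<rho> where "\<rho> = (\<Sum>i\<in>{1..<d}. (y i)\<^sup>2)"
  have c: "0 < cos \<phi>" and s: "0 < sin \<phi>" using \<phi> by (auto simp: cos_gt_zero sin_gt_zero)
  have \<rho>: "0 \<le> \<rho>" unfolding \<rho>_def by (intro sum_nonneg) simp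
  have N: "dot d y y = (y 0)\<^sup>2 + \<rho>" unfolding \<rho>_def by (rule dot_self_split[OF d])
  have y0: "cos \<phi> * t \<le> y 0" "y 0 \<le> cos \<phi>" and r: "sqrt \<rho> \<le> sin \<phi> * t"
    using y by (auto simp: cylinder_def \<rho>_def)
  have y0': "0 \<le> y 0" using y0(1) c t by (meson mult_nonneg_nonneg less_imp_le order_trans)
  have "(sqrt \<rho>)\<^sup>2 \<le> (sin \<phi> * t)\<^sup>2" using r \<rho> by (intro power_mono) auto
  then have \<rho>_le: "\<rho> \<le> (sin \<phi>)\<^sup>2 * t\<^sup>2" using \<rho> by (simp add: power_mult_distrib)
  have "(y 0)\<^sup>2 + \<rho> \<le> (cos \<phi>)\<^sup>2 + (sin \<phi>)\<^sup>2 * 1"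
  proof (intro add_mono)
    show "(y 0)\<^sup>2 \<le> (cos \<phi>)\<^sup>2" using y0 y0' by (intro power_mono) auto
    have "(sin \<phi>)\<^sup>2 * t\<^sup>2 \<le> (sin \<phi>)\<^sup>2 * 1" using t by (intro mult_left_mono) (auto simp: power_le_one)
    then show "\<rho> \<le> (sin \<phi>)\<^sup>2 * 1" using \<rho>_le by simp
  qed
  then have le1: "(y 0)\<^sup>2 + \<rho> \<le> 1" by simp
  have "(cos \<phi> * t)\<^sup>2 \<le> (y 0)\<^sup>2" using y0 c t by (intro power_mono) auto
  then have "(sin \<phi>)\<^sup>2 * (cos \<phi> * t)\<^sup>2 \<le> (sin \<phi>)\<^sup>2 * (y 0)\<^sup>2" by (intro mult_left_mono) auto
  moreover have "(cos \<phi>)\<^sup>2 * \<rho> \<le> (cos \<phi>)\<^sup>2 * ((sin \<phi>)\<^sup>2 * t\<^sup>2)" using \<rho>_le by (intro mult_left_mono) auto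
  ultimately have "(cos \<phi>)\<^sup>2 * \<rho> \<le> (sin \<phi>)\<^sup>2 * (y 0)\<^sup>2" by (simp add: power_mult_distrib mult_ac)
  then have "(cos \<phi>)\<^sup>2 * ((y 0)\<^sup>2 + \<rho>) \<le> (y 0)\<^sup>2"
    by (simp add: sin_squared_eq algebra_simps)
  then have "sqrt ((cos \<phi>)\<^sup>2 * ((y 0)\<^sup>2 + \<rho>)) \<le> y 0" using y0' by (intro real_le_lsqrt) auto
  then have "cos \<phi> * sqrt ((y 0)\<^sup>2 + \<rho>) \<le> y 0" using c by (simp add: real_sqrt_mult)
  then show "y \<in> cone d (pole d) (cos \<phi>)"
    using y le1 d by (auto simp: cylinder_def cone_def unit_ball_def space_PiM dot_pole N)
qed

definition ball_ratio :: "nat \<Rightarrow> real"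
  where "ball_ratio d = unit_ball_vol (real (d - 1)) / unit_ball_vol (real d)"

lemma ball_ratio_pos: "0 < ball_ratio d"
  unfolding ball_ratio_def by (intro divide_pos_pos unit_ball_vol_pos) simp_all

lemma ennreal_cap_area:
  assumes d: "d \<ge> 1"
  shows "ennreal (cap_area d \<phi>) = emeasure (vol d) (cone d (pole d) (cos \<phi>)) / ennreal (unit_ball_vol (real d))"
  using emeasure_cap_eq_cap_area[OF d pole_in_sphere[OF d], of \<phi>] emeasure_spherical_cap[OF d, of "pole d" \<phi>]
  by (simp add: emeasure_unit_ball)

lemma cap_area_upper:
  assumes d: "d \<ge> 1" and \<phi>: "0 < \<phi>" "\<phi> < pi / 2"
  shows "cap_area d \<phi> \<le> ball_ratio d * sin \<phi> ^ (d - 1)"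
proof -
  have s: "0 < sin \<phi>" using \<phi> by (auto simp: sin_gt_zero)
  have "ennreal (cap_area d \<phi>) \<le> emeasure (vol d) (cylinder d 0 1 (sin \<phi>)) / ennreal (unit_ball_vol (real d))"
    unfolding ennreal_cap_area[OF d]
    by (intro divide_right_mono_ennreal emeasure_mono cone_subset_cylinder[OF d \<phi>] cylinder_measurable[OF d])
  also have "\<dots> = ennreal (ball_ratio d * sin \<phi> ^ (d - 1))"
    unfolding emeasure_cylinder[OF d zero_le_one s] ball_ratio_def
    using s by (subst divide_ennreal) (simp_all add: unit_ball_vol_pos less_imp_le)
  finally show ?thesis
    using s ball_ratio_pos[of d] by (subst (asm) ennreal_le_iff) (auto simp: less_imp_le)
qed

text \<open>
  The cylinder with \<open>t = 1 - 1 / d\<close> has height \<open>cos \<phi> / d\<close>, and its radius is small enough to fit while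
  \<open>t ^ (d - 1)\<close> stays bounded away from zero.
\<close>

lemma cap_area_lower:
  assumes d: "d \<ge> 2" and \<phi>: "0 < \<phi>" "\<phi> < pi / 2"
  shows "cap_area d \<phi> \<ge> cos \<phi> / d * (ball_ratio d * (sin \<phi> * (1 - 1 / d)) ^ (d - 1))"
proof -
  define t where "t = 1 - 1 / real d"
  have t: "0 < t" "0 \<le> t" "t \<le> 1" using d by (auto simp: t_def)
  have c: "0 < cos \<phi>" and s: "0 < sin \<phi>" using \<phi> by (auto simp: cos_gt_zero sin_gt_zero)
  have d1: "d \<ge> 1" using d by simp
  have lu: "cos \<phi> * t \<le> cos \<phi>" using c t by simp
  have r: "0 < sin \<phi> * t" using s t by simp
  have w: "cos \<phi> - cos \<phi> * t = cos \<phi> / d" using d by (simp add: t_def field_simps)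
  have "ennreal (cos \<phi> / d * (ball_ratio d * (sin \<phi> * t) ^ (d - 1))) =
      emeasure (vol d) (cylinder d (cos \<phi> * t) (cos \<phi>) (sin \<phi> * t)) / ennreal (unit_ball_vol (real d))"
    unfolding emeasure_cylinder[OF d1 lu r] ball_ratio_def w
    using r c by (subst divide_ennreal) (simp_all add: unit_ball_vol_pos less_imp_le)
  also have "\<dots> \<le> ennreal (cap_area d \<phi>)"
    unfolding ennreal_cap_area[OF d1]
    by (intro divide_right_mono_ennreal emeasure_mono cylinder_subset_cone[OF d1 \<phi> t(2,3)] cone_measurable)
  finally show ?thesis
    by (subst (asm) ennreal_le_iff) (simp_all add: cap_area_def t_def)
qed

lemma nn_integral_cap:
  assumes "d \<ge> 1" "x \<in> unit_sphere d"
  shows "(\<integral>\<^sup>+v. of_bool (v \<in> spherical_cap d x \<phi>) \<partial>sphere_measure d) = ennreal (cap_area d \<phi>)"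
proof -
  have "(\<integral>\<^sup>+v. of_bool (v \<in> spherical_cap d x \<phi>) \<partial>sphere_measure d) =
      (\<integral>\<^sup>+v. indicator (spherical_cap d x \<phi>) v \<partial>sphere_measure d)"
    by (intro nn_integral_cong) (simp add: indicator_def)
  then show ?thesis by (simp add: emeasure_cap_eq_cap_area[OF assms])
qed

lemma cap_area_nonneg: "0 \<le> cap_area d \<phi>"
  by (simp add: cap_area_def)

text \<open>
  A point is contained in caps of arbitrarily small radius.
\<close>

lemma sphere_no_atoms:
  assumes d: "d \<ge> 2" and x: "x \<in> unit_sphere d"
  shows "(\<integral>\<^sup>+v. of_bool (x = v) \<partial>sphere_measure d) = 0"
proof -
  have d1: "d \<ge> 1" using d by simp
  have le: "(\<integral>\<^sup>+v. of_bool (x = v) \<partial>sphere_measure d) \<le> ennreal (ball_ratio d * (1 / real (Suc n)))" for n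
  proof -
    \<comment> \<open>The area of a cap of this radius tends to zero, as \<open>d - 1 \<ge> 1\<close>.\<close>
    let ?\<phi> = "1 / real (Suc n)"
    have \<phi>1: "?\<phi> \<le> 1" by simp
    have \<phi>: "0 < ?\<phi>" "?\<phi> < pi / 2" using \<phi>1 pi_gt3 by (simp, linarith)
    have s: "0 \<le> sin ?\<phi>" 
    proof (rule sin_ge_zero)
      show "0 \<le> ?\<phi>" using \<phi>(1) by (rule less_imp_le)
      show "?\<phi> \<le> pi" using \<phi>(2) pi_gt_zero by linarith
    qed
    have "x \<in> spherical_cap d x ?\<phi>"
      using x cos_le_one[of ?\<phi>] unfolding spherical_cap_def unit_sphere_def by simp
    then have mem: "of_bool (x = v) \<le> (of_bool (v \<in> spherical_cap d x ?\<phi>) :: ennreal)" for v by auto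
    have "(\<integral>\<^sup>+v. of_bool (x = v) \<partial>sphere_measure d) \<le> (\<integral>\<^sup>+v. of_bool (v \<in> spherical_cap d x ?\<phi>) \<partial>sphere_measure d)"
      by (rule nn_integral_mono) (rule mem)
    also have "\<dots> = ennreal (cap_area d ?\<phi>)" by (rule nn_integral_cap[OF d1 x])
    also have "\<dots> \<le> ennreal (ball_ratio d * ?\<phi>)"
    proof (rule ennreal_leI)
      have "sin ?\<phi> ^ (d - 1) \<le> sin ?\<phi> ^ 1"
        by (rule power_decreasing) (use d s in auto)
      also have "sin ?\<phi> ^ 1 \<le> ?\<phi>"
        unfolding power_one_right by (rule sin_x_le_x) (rule less_imp_le[OF \<phi>(1)])
      finally have "ball_ratio d * sin ?\<phi> ^ (d - 1) \<le> ball_ratio d * ?\<phi>"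
        by (rule mult_left_mono) (rule less_imp_le[OF ball_ratio_pos])
      with cap_area_upper[OF d1 \<phi>] show "cap_area d ?\<phi> \<le> ball_ratio d * ?\<phi>"
        by (rule order_trans)
    qed
    finally show ?thesis .
  qed
  have "(\<lambda>n. ball_ratio d * (1 / real (Suc n))) \<longlonglongrightarrow> ball_ratio d * 0"
    by (intro tendsto_intros LIMSEQ_Suc[OF lim_1_over_n])
  from tendsto_ennrealI[OF this]
  have "(\<lambda>n. ennreal (ball_ratio d * (1 / real (Suc n)))) \<longlonglongrightarrow> ennreal (ball_ratio d * 0)" .
  then have "(\<integral>\<^sup>+v. of_bool (x = v) \<partial>sphere_measure d) \<le> ennreal (ball_ratio d * 0)"
    by (rule LIMSEQ_le_const) (intro exI allI impI le)
  then show ?thesis by simp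
qed

section \<open>The hard cap model as a hard-core process\<close>

text \<open>
  Equality of unit vectors is the measurable condition that their inner product is \<open>1\<close>.
\<close>

lemma sphere_hard_core:
  assumes d: "d \<ge> 2" and lam: "lam > 0"
  shows "hard_core_points (sphere_measure d) (\<lambda>x y. cos \<theta> < dot d x y) lam"
proof -
  interpret prob_space "sphere_measure d" using d by (intro prob_space_sphere_measure) simp
  show ?thesis
  proof
    show "cos \<theta> < dot d x y \<longleftrightarrow> cos \<theta> < dot d y x" for x y by (simp add: dot_commute)
    show "Measurable.pred (sphere_measure d \<Otimes>\<^sub>M sphere_measure d) (\<lambda>p. cos \<theta> < dot d (fst p) (snd p))"
      by measurable
    have "Measurable.pred (sphere_measure d \<Otimes>\<^sub>M sphere_measure d) (\<lambda>p. dot d (fst p) (snd p) = 1)"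
      by measurable
    then show "Measurable.pred (sphere_measure d \<Otimes>\<^sub>M sphere_measure d) (\<lambda>p. fst p = snd p)"
    proof (rule measurable_cong[THEN iffD1, rotated])
      fix p assume "p \<in> space (sphere_measure d \<Otimes>\<^sub>M sphere_measure d)"
      then have "fst p \<in> unit_sphere d" "snd p \<in> unit_sphere d"
        by (auto simp: space_pair_measure space_sphere_measure)
      then show "dot d (fst p) (snd p) = 1 \<longleftrightarrow> fst p = snd p"
        using unit_vectors_eq by (auto simp: unit_sphere_def)
    qed
    show "(\<integral>\<^sup>+v. of_bool (x = v) \<partial>sphere_measure d) = 0" if "x \<in> space (sphere_measure d)" for x
      using sphere_no_atoms[OF d] that by (simp add: space_sphere_measure)
  qed fact
qed

lemma expected_size_eq_mean_size:
  assumes "d \<ge> 2" "lam > 0"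
  shows "expected_size d \<theta> lam = hard_core.mean_size (sphere_measure d) (\<lambda>x y. cos \<theta> < dot d x y) lam"
proof -
  interpret hard_core_points "sphere_measure d" "\<lambda>x y. cos \<theta> < dot d x y" lam
    by (rule sphere_hard_core[OF assms])
  have "hard_cap_event d \<theta> lam = conflict_free"
    by (simp add: hard_cap_event_def conflict_free_def not_less)
  then show ?thesis
    using expected_config_size by (simp add: expected_size_def hard_cap_model_def)
qed

section \<open>Intersections of caps\<close>

context
  fixes \<theta> :: real
  assumes \<theta>: "0 < \<theta>" "\<theta> < pi / 2"
begin

lemma cos_bounds: "0 < cos \<theta>" "cos \<theta> < 1" "0 < sin \<theta>"
  using \<theta> cos_monotone_0_pi[of 0 \<theta>] by (auto simp: cos_gt_zero sin_gt_zero)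

text \<open>
  With \<open>c = cos \<theta>\<close> the argument of the inverse sine has square \<open>(1 - c) * (1 + 2 * c) / (1 + c)\<close>, which is
  \<open>1 - 2 * c\<^sup>2 / (1 + c)\<close> and hence lies strictly between \<open>0\<close> and \<open>1\<close>.
\<close>

lemma q_angle_trig:
  shows sin_q_angle: "(sin (q_angle \<theta>))\<^sup>2 = (1 - cos \<theta>) * (1 + 2 * cos \<theta>) / (1 + cos \<theta>)"
    and cos_q_angle: "(cos (q_angle \<theta>))\<^sup>2 = 2 * (cos \<theta>)\<^sup>2 / (1 + cos \<theta>)"
    and q_angle_bounds: "0 < q_angle \<theta>" "q_angle \<theta> < pi / 2"
proof -
  let ?c = "cos \<theta>"
  define s where "s = sqrt ((?c - 1)\<^sup>2 * (1 + 2 * ?c)) / sin \<theta>"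
  have s0: "0 < s" unfolding s_def using cos_bounds by (intro divide_pos_pos) auto
  have "s\<^sup>2 = (?c - 1)\<^sup>2 * (1 + 2 * ?c) / (sin \<theta>)\<^sup>2"
    unfolding s_def using cos_bounds by (simp add: power_divide)
  also have "(sin \<theta>)\<^sup>2 = (1 - ?c) * (1 + ?c)" by (simp add: sin_squared_eq power2_eq_square algebra_simps)
  also have "(?c - 1)\<^sup>2 * (1 + 2 * ?c) / ((1 - ?c) * (1 + ?c)) = (1 - ?c) * (1 + 2 * ?c) / (1 + ?c)"
    using cos_bounds by (simp add: divide_simps power2_eq_square) (simp add: algebra_simps)
  finally have s2: "s\<^sup>2 = (1 - ?c) * (1 + 2 * ?c) / (1 + ?c)" .
  have c2: "1 - s\<^sup>2 = 2 * ?c\<^sup>2 / (1 + ?c)"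
    unfolding s2 using cos_bounds by (simp add: divide_simps power2_eq_square) (simp add: algebra_simps)
  have "0 < 2 * ?c\<^sup>2 / (1 + ?c)" using cos_bounds by (intro divide_pos_pos) auto
  then have "s\<^sup>2 < 1\<^sup>2" using c2 by simp
  then have s1: "s < 1" by (rule power2_less_imp_less) simp
  have q: "q_angle \<theta> = arcsin s" by (simp add: q_angle_def s_def)
  have sq: "sin (q_angle \<theta>) = s" using s0 s1 by (simp add: q)
  show "(sin (q_angle \<theta>))\<^sup>2 = (1 - ?c) * (1 + 2 * ?c) / (1 + ?c)" by (simp only: sq s2)
  show "(cos (q_angle \<theta>))\<^sup>2 = 2 * ?c\<^sup>2 / (1 + ?c)" by (simp only: cos_squared_eq sq c2)
  show "0 < q_angle \<theta>" unfolding q using arcsin_less_arcsin[of 0 s] s0 s1 by simp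
  show "q_angle \<theta> < pi / 2" unfolding q using arcsin_less_arcsin[of s 1] s0 s1 by simp
qed

lemma sin_q_angle_less: "sin (q_angle \<theta>) < sin \<theta>"
proof (rule power2_less_imp_less)
  let ?c = "cos \<theta>"
  have "(1 - ?c) * (1 + 2 * ?c) < (1 - ?c) * ((1 + ?c) * (1 + ?c))"
    using cos_bounds by (intro mult_strict_left_mono) (auto simp: algebra_simps)
  then have "(1 - ?c) * (1 + 2 * ?c) / (1 + ?c) < (1 - ?c) * (1 + ?c)"
    using cos_bounds by (simp add: pos_divide_less_eq mult.assoc)
  also have "(1 - ?c) * (1 + ?c) = (sin \<theta>)\<^sup>2"
    by (simp add: sin_squared_eq power2_eq_square algebra_simps)
  finally show "(sin (q_angle \<theta>))\<^sup>2 < (sin \<theta>)\<^sup>2" by (simp only: sin_q_angle)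
qed (use cos_bounds in simp)

text \<open>
  The cap is centred at the normalized midpoint of \<open>x\<close> and \<open>u\<close>. With \<open>c = cos \<theta>\<close> and \<open>a = dot d x u \<ge> c\<close>, the inner product of this
  centre with \<open>v\<close> is at least \<open>(a + c) / sqrt (2 + 2 * a)\<close>. This increases with \<open>a\<close>, and for \<open>a = c\<close> it
  equals \<open>cos (q_angle \<theta>)\<close>.
\<close>

lemma common_cap:
  assumes x: "x \<in> unit_sphere d" and u: "u \<in> unit_sphere d" and xu: "cos \<theta> \<le> dot d x u"
  shows "\<exists>w\<in>unit_sphere d. \<forall>v\<in>unit_sphere d. cos \<theta> \<le> dot d u v \<and> dot d x u \<le> dot d x v \<longrightarrow>
    v \<in> spherical_cap d w (q_angle \<theta>)"
proof -
  let ?c = "cos \<theta>" and ?a = "dot d x u"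
  define m where "m = (\<lambda>i\<in>{..<d}. x i + 1 * u i)"
  have m: "dot d z m = dot d z x + dot d z u" for z
    unfolding m_def dot_add_scaled by simp
  have xx: "dot d x x = 1" "dot d u u = 1" using x u by (auto simp: unit_sphere_def)
  have ux: "dot d u x = dot d x u" by (rule dot_commute)
  have "dot d m x = 1 + ?a" "dot d m u = 1 + ?a"
    unfolding dot_commute[of d m x] dot_commute[of d m u] m by (simp_all add: xx ux)
  then have mm: "dot d m m = 2 + 2 * ?a" unfolding m[of m] by simp
  have pos: "0 < dot d m m" unfolding mm using xu cos_bounds by simp
  show ?thesis
  proof (intro bexI[of _ "radial_projection d m"] ballI impI)
    show "radial_projection d m \<in> unit_sphere d" by (rule radial_projection_in_sphere[OF pos])
    fix v assume v: "v \<in> unit_sphere d" and *: "?c \<le> dot d u v \<and> ?a \<le> dot d x v"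
    have "dot d (radial_projection d m) v = dot d v m / sqrt (dot d m m)"
      unfolding dot_commute[of d "radial_projection d m" v] by (rule dot_radial_projection_right)
    also have "dot d v m = dot d x v + dot d u v"
      unfolding m by (simp only: dot_commute[of d v x] dot_commute[of d v u])
    finally have eq: "dot d (radial_projection d m) v = (dot d x v + dot d u v) / sqrt (2 + 2 * ?a)"
      by (simp only: mm)
    have pos1: "0 < 1 + ?c" and pos2: "0 < 2 + 2 * ?a"
      using pos cos_bounds unfolding mm by auto
    have "(cos (q_angle \<theta>))\<^sup>2 \<le> ((?a + ?c) / sqrt (2 + 2 * ?a))\<^sup>2"
    proof -
      \<comment> \<open>This product is the difference \<open>(a + c)\<^sup>2 * (1 + c) - 2 * c\<^sup>2 * (2 + 2 * a)\<close>.\<close>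
      have "0 \<le> (?a - ?c) * (4 * ?c + (?a - ?c) * (1 + ?c))"
        using xu cos_bounds by (intro mult_nonneg_nonneg add_nonneg_nonneg) auto
      then have "2 * ?c\<^sup>2 * (2 + 2 * ?a) \<le> (?a + ?c)\<^sup>2 * (1 + ?c)"
        by (simp add: power2_eq_square algebra_simps)
      then have "2 * ?c\<^sup>2 / (1 + ?c) \<le> (?a + ?c)\<^sup>2 / (2 + 2 * ?a)"
        using pos1 pos2 by (simp only: pos_divide_le_eq times_divide_eq_left pos_le_divide_eq)
      then show ?thesis
        using pos unfolding mm cos_q_angle by (simp add: power_divide)
    qed
    then have "cos (q_angle \<theta>) \<le> (?a + ?c) / sqrt (2 + 2 * ?a)"
    proof (rule power2_le_imp_le)
      have "0 \<le> ?a + ?c" using xu cos_bounds(1) by linarith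
      then show "0 \<le> (?a + ?c) / sqrt (2 + 2 * ?a)"
        by (rule divide_nonneg_nonneg) (use pos2 in simp)
    qed
    also have "\<dots> \<le> (dot d x v + dot d u v) / sqrt (2 + 2 * ?a)"
      by (rule divide_right_mono[OF add_mono[OF conjunct2[OF *] conjunct1[OF *]]]) (use pos2 in simp)
    finally show "v \<in> spherical_cap d (radial_projection d m) (q_angle \<theta>)"
      using v by (simp add: spherical_cap_def eq)
  qed
qed

text \<open>
  Order each pair of points of \<open>T\<close> at angle less than \<open>\<theta>\<close> by the distance to \<open>u\<close>, which costs the factor \<open>2\<close>.
  For a given farther point \<open>v\<close>, the nearer points lie in one cap of radius \<open>q_angle \<theta>\<close>.
\<close>

lemma mean_overlap_bound:
  assumes d: "d \<ge> 1" and u: "u \<in> unit_sphere d"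
    and T [measurable]: "Measurable.pred (sphere_measure d) T" and TK: "\<And>v. T v \<Longrightarrow> cos \<theta> < dot d u v"
  shows "(\<integral>\<^sup>+v. of_bool (T v) * (\<integral>\<^sup>+v'. of_bool (T v' \<and> cos \<theta> < dot d v v') \<partial>sphere_measure d) \<partial>sphere_measure d) \<le>
    ennreal (2 * cap_area d (q_angle \<theta>)) * (\<integral>\<^sup>+v. of_bool (T v) \<partial>sphere_measure d)"
proof -
  let ?S = "sphere_measure d"
  interpret prob_space ?S by (rule prob_space_sphere_measure[OF d])
  interpret SS: pair_sigma_finite ?S ?S ..
  define B where "B v v' \<longleftrightarrow> T v \<and> T v' \<and> cos \<theta> < dot d v v' \<and> dot d u v \<le> dot d u v'" for v v'
  have u': "u \<in> space ?S" using u by (simp add: space_sphere_measure)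
  \<comment> \<open>Both orders of the arguments are needed, on the product space and on its sections.\<close>
  have B_measurable: "Measurable.pred M (\<lambda>z. B (f z) (g z))"
    if f: "f \<in> measurable M ?S" and g: "g \<in> measurable M ?S" for f g and M :: "'m measure"
  proof -
    have [measurable]: "Measurable.pred M (\<lambda>z. T (f z))" "Measurable.pred M (\<lambda>z. T (g z))"
      using measurable_compose[OF f T] measurable_compose[OF g T] by simp_all
    have [measurable]: "(\<lambda>z. dot d (f z) (g z)) \<in> borel_measurable M"
      "(\<lambda>z. dot d u (f z)) \<in> borel_measurable M" "(\<lambda>z. dot d u (g z)) \<in> borel_measurable M"
      using f g u' by (intro dot_sphere_measurable measurable_const; simp)+
    show ?thesis unfolding B_def by measurable
  qed
  have [measurable]: "Measurable.pred (?S \<Otimes>\<^sub>M ?S) (\<lambda>p. B (fst p) (snd p))"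
    "Measurable.pred (?S \<Otimes>\<^sub>M ?S) (\<lambda>p. B (snd p) (fst p))"
    by (intro B_measurable measurable_fst measurable_snd)+
  have one: "(\<integral>\<^sup>+v. \<integral>\<^sup>+v'. of_bool (B v v') \<partial>?S \<partial>?S) \<le> ennreal (cap_area d (q_angle \<theta>)) * (\<integral>\<^sup>+v. of_bool (T v) \<partial>?S)"
  proof -
    have "(\<integral>\<^sup>+v. \<integral>\<^sup>+v'. of_bool (B v v') \<partial>?S \<partial>?S) \<le> (\<integral>\<^sup>+v. ennreal (cap_area d (q_angle \<theta>)) * of_bool (T v) \<partial>?S)"
    proof (rule nn_integral_mono)
      fix v assume "v \<in> space ?S"
      then have v: "v \<in> unit_sphere d" by (simp add: space_sphere_measure)
      show "(\<integral>\<^sup>+v'. of_bool (B v v') \<partial>?S) \<le> ennreal (cap_area d (q_angle \<theta>)) * of_bool (T v)"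
      proof (cases "T v")
        case True
        then obtain w where w: "w \<in> unit_sphere d" and
          cap: "\<And>v'. v' \<in> unit_sphere d \<Longrightarrow> cos \<theta> \<le> dot d v v' \<and> dot d u v \<le> dot d u v' \<Longrightarrow> v' \<in> spherical_cap d w (q_angle \<theta>)"
          using common_cap[OF u v] TK[of v] by (auto simp: less_imp_le)
        have "(\<integral>\<^sup>+v'. of_bool (B v v') \<partial>?S) \<le> (\<integral>\<^sup>+v'. of_bool (v' \<in> spherical_cap d w (q_angle \<theta>)) \<partial>?S)"
          using cap by (intro nn_integral_mono) (auto simp: B_def space_sphere_measure)
        then show ?thesis using True by (simp add: nn_integral_cap[OF d w])
      qed (simp add: B_def)
    qed
    also have "\<dots> = ennreal (cap_area d (q_angle \<theta>)) * (\<integral>\<^sup>+v. of_bool (T v) \<partial>?S)"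
      by (rule nn_integral_cmult) measurable
    finally show ?thesis .
  qed
  have swap: "(\<integral>\<^sup>+v. \<integral>\<^sup>+v'. of_bool (B v' v) \<partial>?S \<partial>?S) = (\<integral>\<^sup>+v. \<integral>\<^sup>+v'. of_bool (B v v') \<partial>?S \<partial>?S)"
    by (rule SS.Fubini') (simp add: case_prod_beta')
  have inner [measurable]: "(\<lambda>v. \<integral>\<^sup>+v'. of_bool (B v v') \<partial>?S) \<in> borel_measurable ?S"
    "(\<lambda>v. \<integral>\<^sup>+v'. of_bool (B v' v) \<partial>?S) \<in> borel_measurable ?S"
    by (intro borel_measurable_nn_integral, simp add: case_prod_beta')+
  have "(\<integral>\<^sup>+v. of_bool (T v) * (\<integral>\<^sup>+v'. of_bool (T v' \<and> cos \<theta> < dot d v v') \<partial>?S) \<partial>?S) \<le>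
      (\<integral>\<^sup>+v. (\<integral>\<^sup>+v'. of_bool (B v v') \<partial>?S) + (\<integral>\<^sup>+v'. of_bool (B v' v) \<partial>?S) \<partial>?S)"
  proof (rule nn_integral_mono)
    fix v assume v: "v \<in> space ?S"
    have [measurable]: "Measurable.pred ?S (\<lambda>v'. B v v')" "Measurable.pred ?S (\<lambda>v'. B v' v)"
      using v by (intro B_measurable measurable_const measurable_ident; simp)+
    have "of_bool (T v) * (\<integral>\<^sup>+v'. of_bool (T v' \<and> cos \<theta> < dot d v v') \<partial>?S) =
        (\<integral>\<^sup>+v'. of_bool (T v) * of_bool (T v' \<and> cos \<theta> < dot d v v') \<partial>?S)"
      by (rule nn_integral_cmult[symmetric]) measurable
    also have "\<dots> \<le> (\<integral>\<^sup>+v'. of_bool (B v v') + of_bool (B v' v) \<partial>?S)"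
    proof (rule nn_integral_mono)
      fix v'
      have "dot d v' v = dot d v v'" by (rule dot_commute)
      then show "of_bool (T v) * of_bool (T v' \<and> cos \<theta> < dot d v v') \<le> (of_bool (B v v') + of_bool (B v' v) :: ennreal)"
        by (auto simp: B_def)
    qed
    also have "\<dots> = (\<integral>\<^sup>+v'. of_bool (B v v') \<partial>?S) + (\<integral>\<^sup>+v'. of_bool (B v' v) \<partial>?S)"
      by (rule nn_integral_add) measurable
    finally show "of_bool (T v) * (\<integral>\<^sup>+v'. of_bool (T v' \<and> cos \<theta> < dot d v v') \<partial>?S) \<le> \<dots>" .
  qed
  also have "\<dots> = (\<integral>\<^sup>+v. \<integral>\<^sup>+v'. of_bool (B v v') \<partial>?S \<partial>?S) + (\<integral>\<^sup>+v. \<integral>\<^sup>+v'. of_bool (B v' v) \<partial>?S \<partial>?S)"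
    by (rule nn_integral_add) measurable
  also have "\<dots> \<le> ennreal (cap_area d (q_angle \<theta>)) * (\<integral>\<^sup>+v. of_bool (T v) \<partial>?S) +
      ennreal (cap_area d (q_angle \<theta>)) * (\<integral>\<^sup>+v. of_bool (T v) \<partial>?S)"
    unfolding swap by (intro add_mono one)
  also have "\<dots> = ennreal (2 * cap_area d (q_angle \<theta>)) * (\<integral>\<^sup>+v. of_bool (T v) \<partial>?S)"
    using cap_area_nonneg[of d "q_angle \<theta>"]
    by (simp only: mult_2 ennreal_plus distrib_right)
  finally show ?thesis .
qed

end

section \<open>Balancing the two bounds\<close>

context
  fixes \<theta> :: real
  assumes \<theta>: "0 < \<theta>" "\<theta> < pi / 2"
begin

lemma sin_q_angle_pos: "0 < sin (q_angle \<theta>)"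
  using q_angle_bounds[OF \<theta>] by (intro sin_gt_zero) auto

lemma c_const_pos: "0 < c_const \<theta>"
  using sin_q_angle_pos sin_q_angle_less[OF \<theta>] by (simp add: c_const_def)

lemma cap_area_pos:
  assumes d: "d \<ge> 2" and \<phi>: "0 < \<phi>" "\<phi> < pi / 2" shows "0 < cap_area d \<phi>"
proof -
  have "0 < cos \<phi>" "0 < sin \<phi>" using \<phi> by (auto simp: cos_gt_zero sin_gt_zero)
  moreover have "0 < 1 - 1 / real d" using d by simp
  ultimately have "0 < cos \<phi> / d * (ball_ratio d * (sin \<phi> * (1 - 1 / d)) ^ (d - 1))"
    using d ball_ratio_pos[of d] by (intro mult_pos_pos divide_pos_pos zero_less_power) auto
  then show ?thesis using cap_area_lower[OF d \<phi>] by linarith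
qed

lemma exp_minus_1_le_power:
  assumes "d \<ge> 2" shows "exp (- 1) \<le> (1 - 1 / real d) ^ (d - 1)"
proof -
  define m where "m = real (d - 1)"
  have m: "0 < m" and dm: "real d = m + 1" using assms by (auto simp: m_def)
  have b: "1 - 1 / real d = inverse (1 + 1 / m)" using m by (simp add: dm field_simps)
  have "(1 + 1 / m) ^ (d - 1) \<le> exp (1 / m) ^ (d - 1)"
    using m exp_ge_add_one_self[of "1 / m"] by (intro power_mono) auto
  also have "\<dots> = exp (m * (1 / m))" unfolding m_def by (rule exp_of_nat_mult[symmetric])
  also have "\<dots> = exp 1" using m by simp
  finally have "inverse (exp 1) \<le> inverse ((1 + 1 / m) ^ (d - 1))"
    using m by (intro le_imp_inverse_le zero_less_power) (auto intro: add_pos_pos)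
  then show ?thesis by (simp add: b power_inverse exp_minus)
qed

text \<open>
  The volumes of the balls of dimension \<open>d - 1\<close> and \<open>d\<close> cancel, and \<open>c_const \<theta>\<close> is the logarithm of
  \<open>sin \<theta> / sin (q_angle \<theta>)\<close>.
\<close>

lemma cap_area_ratio:
  assumes d: "d \<ge> 2"
  shows "cos \<theta> / real d * exp (c_const \<theta> * (real d - 1) - 1) * cap_area d (q_angle \<theta>) \<le> cap_area d \<theta>"
proof -
  let ?q = "q_angle \<theta>"
  have d1: "d \<ge> 1" using d by simp
  note pos = cos_bounds[OF \<theta>] sin_q_angle_pos ball_ratio_pos[of d]
  have "exp (c_const \<theta> * (real d - 1) - 1) = exp (real (d - 1) * c_const \<theta>) * exp (- 1)"
    using d by (simp add: exp_add[symmetric] of_nat_diff mult.commute)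
  also have "exp (real (d - 1) * c_const \<theta>) = (sin \<theta> / sin ?q) ^ (d - 1)"
    using pos by (simp add: exp_of_nat_mult c_const_def)
  finally have e: "exp (c_const \<theta> * (real d - 1) - 1) = (sin \<theta> / sin ?q) ^ (d - 1) * exp (- 1)" .
  have "cos \<theta> / real d * exp (c_const \<theta> * (real d - 1) - 1) * cap_area d ?q \<le>
      cos \<theta> / real d * exp (c_const \<theta> * (real d - 1) - 1) * (ball_ratio d * sin ?q ^ (d - 1))"
    using pos d by (intro mult_left_mono cap_area_upper[OF d1 q_angle_bounds[OF \<theta>]] mult_nonneg_nonneg divide_nonneg_nonneg) auto
  also have "\<dots> = cos \<theta> / real d * (ball_ratio d * sin \<theta> ^ (d - 1) * exp (- 1))"
    unfolding e using pos by (simp add: power_divide)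
  also have "\<dots> \<le> cos \<theta> / real d * (ball_ratio d * sin \<theta> ^ (d - 1) * (1 - 1 / real d) ^ (d - 1))"
    using pos d by (intro mult_left_mono exp_minus_1_le_power[OF d] mult_nonneg_nonneg divide_nonneg_nonneg) auto
  also have "\<dots> = cos \<theta> / d * (ball_ratio d * (sin \<theta> * (1 - 1 / d)) ^ (d - 1))"
    by (simp only: power_mult_distrib mult.assoc)
  also have "\<dots> \<le> cap_area d \<theta>" by (rule cap_area_lower[OF d \<theta>])
  finally show ?thesis .
qed

lemma expected_size_bounds:
  assumes d: "d \<ge> 2" and lam: "lam > 0"
  obtains z where "lam * exp (- z) \<le> expected_size d \<theta> lam"
    "z * exp (- lam * (2 * cap_area d (q_angle \<theta>))) \<le> expected_size d \<theta> lam * cap_area d \<theta>"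
proof -
  have d1: "d \<ge> 1" using d by simp
  interpret hard_core_points "sphere_measure d" "\<lambda>x y. cos \<theta> < dot d x y" lam
    by (rule sphere_hard_core[OF d lam])
  have p: "(\<integral>\<^sup>+v. of_bool (cos \<theta> < dot d v u) \<partial>sphere_measure d) \<le> ennreal (cap_area d \<theta>)"
    if "u \<in> space (sphere_measure d)" for u
  proof -
    have u: "u \<in> unit_sphere d" using that by (simp add: space_sphere_measure)
    have "(\<integral>\<^sup>+v. of_bool (cos \<theta> < dot d v u) \<partial>sphere_measure d) \<le>
        (\<integral>\<^sup>+v. of_bool (v \<in> spherical_cap d u \<theta>) \<partial>sphere_measure d)"
    proof (rule nn_integral_mono)
      fix v assume "v \<in> space (sphere_measure d)"
      then show "of_bool (cos \<theta> < dot d v u) \<le> (of_bool (v \<in> spherical_cap d u \<theta>) :: ennreal)"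
        using dot_commute[of d u v] by (auto simp: spherical_cap_def space_sphere_measure)
    qed
    also have "\<dots> = ennreal (cap_area d \<theta>)" by (rule nn_integral_cap[OF d1 u])
    finally show ?thesis .
  qed
  have r: "(\<integral>\<^sup>+v. of_bool (T v) * (\<integral>\<^sup>+v'. of_bool (T v' \<and> cos \<theta> < dot d v v') \<partial>sphere_measure d) \<partial>sphere_measure d) \<le>
      ennreal (2 * cap_area d (q_angle \<theta>)) * (\<integral>\<^sup>+v. of_bool (T v) \<partial>sphere_measure d)"
    if "u \<in> space (sphere_measure d)" "Measurable.pred (sphere_measure d) T" "\<And>v. T v \<Longrightarrow> cos \<theta> < dot d u v" for u T
    using that by (intro mean_overlap_bound[OF \<theta> d1]) (auto simp: space_sphere_measure)
  show ?thesis
  proof (rule mean_size_bounds[of "cap_area d \<theta>" "2 * cap_area d (q_angle \<theta>)"])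
    fix z assume "lam * exp (- z) \<le> mean_size"
      "z * exp (- lam * (2 * cap_area d (q_angle \<theta>))) \<le> mean_size * cap_area d \<theta>"
    then show thesis
      using that[of z] unfolding expected_size_eq_mean_size[OF d lam] by blast
  qed (fact p, fact cap_area_nonneg, fact r, simp add: cap_area_nonneg)
qed

text \<open>
  The value \<open>w * exp (- 2 / d) / (c_const \<theta> * d)\<close>, where \<open>w\<close> is the threshold for \<open>z\<close> at which the
  first of the two bounds, with the cap areas estimated by \<open>cap_area_ratio\<close>, equals
  \<open>c_const \<theta> * d / cap_area d \<theta>\<close>.
\<close>

definition rate :: "nat \<Rightarrow> real"
  where "rate d = exp (- 2 / real d) *
    (ln (cos \<theta>) - ln (real d) + c_const \<theta> * (real d - 1) - 1 - ln (c_const \<theta> * (real d)\<^sup>2)) / (c_const \<theta> * real d)"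

lemma rate_tendsto_1: "rate \<longlonglongrightarrow> 1"
  unfolding rate_def using c_const_pos by real_asymp

text \<open>
  At the smallest admissible intensity \<open>lam0\<close>, use the second bound if \<open>z\<close> is at least the threshold \<open>w\<close>,
  and the first one otherwise; larger intensities follow by monotonicity.
\<close>

lemma expected_size_lower_bound:
  assumes d: "d \<ge> 2" and lam: "lam \<ge> 1 / (real d * cap_area d (q_angle \<theta>))"
  shows "min 1 (rate d) * (c_const \<theta> * real d / cap_area d \<theta>) \<le> expected_size d \<theta> lam"
proof -
  let ?c = "c_const \<theta>" and ?s = "cap_area d \<theta>" and ?sq = "cap_area d (q_angle \<theta>)"
  define lam0 where "lam0 = 1 / (real d * ?sq)"
  define X where "X = ?c * real d / ?s"
  define w where "w = ln (cos \<theta>) - ln (real d) + ?c * (real d - 1) - 1 - ln (?c * (real d)\<^sup>2)"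
  have s: "0 < ?s" and sq: "0 < ?sq" and dp: "0 < real d"
    using cap_area_pos[OF d] \<theta> q_angle_bounds[OF \<theta>] d by auto
  have lam0: "0 < lam0" unfolding lam0_def using sq dp by (intro divide_pos_pos mult_pos_pos) auto
  have X: "0 \<le> X" unfolding X_def using c_const_pos dp s by (intro divide_nonneg_nonneg mult_nonneg_nonneg) auto
  obtain z where z: "lam0 * exp (- z) \<le> expected_size d \<theta> lam0"
    "z * exp (- lam0 * (2 * ?sq)) \<le> expected_size d \<theta> lam0 * ?s"
    using expected_size_bounds[OF d lam0] by blast
  have "exp w = cos \<theta> / real d * exp (?c * (real d - 1) - 1) / (?c * (real d)\<^sup>2)"
    using cos_bounds[OF \<theta>] dp c_const_pos
    by (simp add: w_def exp_add exp_diff)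
  then have ew: "exp w * (?c * (real d)\<^sup>2) * ?sq \<le> ?s"
    using cap_area_ratio[OF d] c_const_pos dp by simp
  have "min 1 (rate d) * X \<le> expected_size d \<theta> lam0"
  proof (cases "w \<le> z")
    case True
    have "lam0 * (2 * ?sq) = 2 / real d" using sq dp by (simp add: lam0_def)
    then have "z * exp (- 2 / real d) \<le> expected_size d \<theta> lam0 * ?s" using z(2) by simp
    moreover have "w * exp (- 2 / real d) \<le> z * exp (- 2 / real d)"
      using True by (intro mult_right_mono) auto
    ultimately have "w * exp (- 2 / real d) \<le> expected_size d \<theta> lam0 * ?s" by linarith
    then have "w * exp (- 2 / real d) / ?s \<le> expected_size d \<theta> lam0"
      using s by (simp add: pos_divide_le_eq)
    moreover have "rate d * X = w * exp (- 2 / real d) / ?s"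
      using c_const_pos dp s by (simp add: rate_def X_def w_def)
    moreover have "min 1 (rate d) * X \<le> rate d * X" using X by (intro mult_right_mono) auto
    ultimately show ?thesis by linarith
  next
    case False
    \<comment> \<open>Here \<open>z < w\<close>, and \<open>w\<close> was chosen so that \<open>lam0 * exp (- w) \<ge> X\<close>.\<close>
    have "X = lam0 * (?c * (real d)\<^sup>2 * ?sq / ?s)"
      using sq dp by (simp add: X_def lam0_def power2_eq_square)
    also have "\<dots> \<le> lam0 * exp (- w)"
    proof (intro mult_left_mono)
      have "?c * (real d)\<^sup>2 * ?sq = exp (- w) * (exp w * (?c * (real d)\<^sup>2) * ?sq)"
        by (simp add: exp_minus)
      also have "\<dots> \<le> exp (- w) * ?s" by (intro mult_left_mono ew) simp
      finally show "?c * (real d)\<^sup>2 * ?sq / ?s \<le> exp (- w)" using s by (simp add: pos_divide_le_eq)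
    qed (use lam0 in simp)
    also have "\<dots> \<le> lam0 * exp (- z)" using False lam0 by (intro mult_left_mono) auto
    also have "\<dots> \<le> expected_size d \<theta> lam0" by (rule z(1))
    finally have "X \<le> expected_size d \<theta> lam0" .
    moreover have "min 1 (rate d) * X \<le> 1 * X" using X by (intro mult_right_mono) auto
    ultimately show ?thesis by simp
  qed
  also have "expected_size d \<theta> lam0 \<le> expected_size d \<theta> lam"
  proof -
    have le: "lam0 \<le> lam" using lam by (simp add: lam0_def)
    then have lam_pos: "0 < lam" using lam0 by simp
    show ?thesis
      unfolding expected_size_eq_mean_size[OF d lam0] expected_size_eq_mean_size[OF d lam_pos]
      using sphere_hard_core[OF d lam0, of \<theta>] sphere_hard_core[OF d lam_pos, of \<theta>] le
      by (intro mean_size_mono) (auto simp: hard_core_points_def)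
  qed
  finally show ?thesis by (simp only: X_def)
qed

end

theorem theorem4:
  fixes \<theta> :: real
  assumes "0 < \<theta>" and "\<theta> < pi / 2"
  shows "\<exists>\<epsilon> :: nat \<Rightarrow> real. \<epsilon> \<longlonglongrightarrow> 0 \<and>
    (\<forall>d\<ge>2. \<forall>lam. lam \<ge> 1 / (real d * cap_area d (q_angle \<theta>)) \<longrightarrow>
       expected_size d \<theta> lam \<ge> (1 + \<epsilon> d) * (c_const \<theta> * real d / cap_area d \<theta>))"
proof (intro exI[of _ "\<lambda>d. min 1 (rate \<theta> d) - 1"] conjI allI impI)
  have "(\<lambda>d. min 1 (rate \<theta> d) - 1) \<longlonglongrightarrow> min 1 1 - 1"
    by (intro tendsto_intros rate_tendsto_1 assms)
  then show "(\<lambda>d. min 1 (rate \<theta> d) - 1) \<longlonglongrightarrow> 0" by simp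
  fix d :: nat and lam :: real
  assume "2 \<le> d" "lam \<ge> 1 / (real d * cap_area d (q_angle \<theta>))"
  then show "(1 + (min 1 (rate \<theta> d) - 1)) * (c_const \<theta> * real d / cap_area d \<theta>) \<le> expected_size d \<theta> lam"
    using expected_size_lower_bound[OF assms] by simp
qed

end
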